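(* Let $M$ and $N$ be semisimple MV-algebras and $p\colon M\to N$ a probability map. There exists a unique unital positive linear operator $L_p\colon C_{\mathbb{R}}(\operatorname{Max}M)\to C_{\mathbb{R}}(\operatorname{Max}N)$ such that $p(a)^{*}=L_p(a^{*})$ for every $a\in M$.
   Context: For an MV-algebra $(M,\oplus,\neg,0)$: $1\coloneqq\neg 0$, $a\vee b\coloneqq\neg(\neg a\oplus b)\oplus b$, $a\wedge b\coloneqq\neg(\neg a\vee\neg b)$. A probability map is a function $p\colon M\to N$ between MV-algebras such that for all $a,b\in M$: (P1) $p(a\oplus b)=p(a)\oplus p(b\wedge\neg a)$; (P2) $p(\neg a)=\neg p(a)$; (P3) $p(1)=1$. $\operatorname{Max}M$ is the compact Hausdorff space of maximal ideals of $M$ (with the hull-kernel topology). For each $\mathfrak{m}\in\operatorname{Max}M$ there is a unique MV-isomorphism $h_{\mathfrak{m}}$ of $M/\mathfrak{m}$ onto an MV-subalgebra of the standard MV-algebra $[0,1]$; for $a\in M$, $a^{*}\colon\operatorname{Max}M\to[0,1]$ is defined by $a^*(\mathfrak{m})=h_{\mathfrak{m}}(a/\mathfrak{m})$, which is continuous. $M$ is semisimple if the intersection of all maximal ideals is $\{0\}$ (equivalently $a\mapsto a^*$ is injective). $C_{\mathbb{R}}(X)$ is the Banach lattice of continuous real functions on $X$ with the sup norm; a unital positive linear operator $L\colon C_{\mathbb{R}}(X)\to C_{\mathbb{R}}(Y)$ is a linear map with $L(a)\geq 0$ whenever $a\geq 0$ and $L(1)=1$. *)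

theory Defs
  imports "HOL-Analysis.Analysis" "HOL-Library.FuncSet"
begin

definition mv_algebra :: "('a \<Rightarrow> 'a \<Rightarrow> 'a) \<Rightarrow> ('a \<Rightarrow> 'a) \<Rightarrow> 'a \<Rightarrow> bool" where
  "mv_algebra pl ng z \<longleftrightarrow>
     (\<forall>x y w. pl (pl x y) w = pl x (pl y w)) \<and>
     (\<forall>x y. pl x y = pl y x) \<and>
     (\<forall>x. pl x z = x) \<and>
     (\<forall>x. ng (ng x) = x) \<and>
     (\<forall>x. pl x (ng z) = ng z) \<and>
     (\<forall>x y. pl (ng (pl (ng x) y)) y = pl (ng (pl (ng y) x)) x)"

definition mv_join :: "('a \<Rightarrow> 'a \<Rightarrow> 'a) \<Rightarrow> ('a \<Rightarrow> 'a) \<Rightarrow> 'a \<Rightarrow> 'a \<Rightarrow> 'a" where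
  "mv_join pl ng a b = pl (ng (pl (ng a) b)) b"

definition mv_meet :: "('a \<Rightarrow> 'a \<Rightarrow> 'a) \<Rightarrow> ('a \<Rightarrow> 'a) \<Rightarrow> 'a \<Rightarrow> 'a \<Rightarrow> 'a" where
  "mv_meet pl ng a b = ng (mv_join pl ng (ng a) (ng b))"

definition mv_le :: "('a \<Rightarrow> 'a \<Rightarrow> 'a) \<Rightarrow> ('a \<Rightarrow> 'a) \<Rightarrow> 'a \<Rightarrow> 'a \<Rightarrow> 'a \<Rightarrow> bool" where
  "mv_le pl ng z a b \<longleftrightarrow> pl (ng a) b = ng z"

definition mv_ideal :: "('a \<Rightarrow> 'a \<Rightarrow> 'a) \<Rightarrow> ('a \<Rightarrow> 'a) \<Rightarrow> 'a \<Rightarrow> 'a set \<Rightarrow> bool" where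
  "mv_ideal pl ng z I \<longleftrightarrow> z \<in> I \<and> (\<forall>a\<in>I. \<forall>b\<in>I. pl a b \<in> I) \<and>
     (\<forall>a\<in>I. \<forall>b. mv_le pl ng z b a \<longrightarrow> b \<in> I)"

definition mv_maximal_ideal :: "('a \<Rightarrow> 'a \<Rightarrow> 'a) \<Rightarrow> ('a \<Rightarrow> 'a) \<Rightarrow> 'a \<Rightarrow> 'a set \<Rightarrow> bool" where
  "mv_maximal_ideal pl ng z I \<longleftrightarrow> mv_ideal pl ng z I \<and> I \<noteq> UNIV \<and>
     (\<forall>J. mv_ideal pl ng z J \<and> I \<subseteq> J \<longrightarrow> J = I \<or> J = UNIV)"

definition mv_Max :: "('a \<Rightarrow> 'a \<Rightarrow> 'a) \<Rightarrow> ('a \<Rightarrow> 'a) \<Rightarrow> 'a \<Rightarrow> 'a set set" where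
  "mv_Max pl ng z = {I. mv_maximal_ideal pl ng z I}"

definition mv_max_topology :: "('a \<Rightarrow> 'a \<Rightarrow> 'a) \<Rightarrow> ('a \<Rightarrow> 'a) \<Rightarrow> 'a \<Rightarrow> 'a set topology" where
  "mv_max_topology pl ng z = topology (\<lambda>U. \<exists>S. U = mv_Max pl ng z - {m \<in> mv_Max pl ng z. S \<subseteq> m})"

definition mv_semisimple :: "('a \<Rightarrow> 'a \<Rightarrow> 'a) \<Rightarrow> ('a \<Rightarrow> 'a) \<Rightarrow> 'a \<Rightarrow> bool" where
  "mv_semisimple pl ng z \<longleftrightarrow> \<Inter> (mv_Max pl ng z) = {z}"

definition std_plus :: "real \<Rightarrow> real \<Rightarrow> real" where "std_plus x y = min 1 (x + y)"
definition std_neg :: "real \<Rightarrow> real" where "std_neg x = 1 - x"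

definition mv_hom_std :: "('a \<Rightarrow> 'a \<Rightarrow> 'a) \<Rightarrow> ('a \<Rightarrow> 'a) \<Rightarrow> 'a \<Rightarrow> ('a \<Rightarrow> real) \<Rightarrow> bool" where
  "mv_hom_std pl ng z h \<longleftrightarrow> (\<forall>x. h x \<in> {0..1}) \<and>
     (\<forall>x y. h (pl x y) = std_plus (h x) (h y)) \<and> (\<forall>x. h (ng x) = std_neg (h x)) \<and> h z = 0"

text \<open>a*(m) = h_m(a/m), where h_m composed with the quotient map M \<rightarrow> M/m is
  the unique MV-homomorphism M \<rightarrow> [0,1] with kernel m.\<close>
definition mv_star :: "('a \<Rightarrow> 'a \<Rightarrow> 'a) \<Rightarrow> ('a \<Rightarrow> 'a) \<Rightarrow> 'a \<Rightarrow> 'a \<Rightarrow> ('a set \<Rightarrow> real)" where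
  "mv_star pl ng z a = restrict (\<lambda>m. THE r. \<exists>h. mv_hom_std pl ng z h \<and> {x. h x = 0} = m \<and> h a = r)
     (mv_Max pl ng z)"

definition prob_map :: "('a \<Rightarrow> 'a \<Rightarrow> 'a) \<Rightarrow> ('a \<Rightarrow> 'a) \<Rightarrow> 'a \<Rightarrow>
    ('b \<Rightarrow> 'b \<Rightarrow> 'b) \<Rightarrow> ('b \<Rightarrow> 'b) \<Rightarrow> 'b \<Rightarrow> ('a \<Rightarrow> 'b) \<Rightarrow> bool" where
  "prob_map plM ngM zM plN ngN zN p \<longleftrightarrow>
     (\<forall>a b. p (plM a b) = plN (p a) (p (mv_meet plM ngM b (ngM a)))) \<and>
     (\<forall>a. p (ngM a) = ngN (p a)) \<and>
     p (ngM zM) = ngN zN"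

definition cfun :: "'x topology \<Rightarrow> ('x \<Rightarrow> real) set" where
  "cfun X = {f. continuous_map X euclideanreal f \<and> f \<in> extensional (topspace X)}"

definition cadd :: "'x topology \<Rightarrow> ('x \<Rightarrow> real) \<Rightarrow> ('x \<Rightarrow> real) \<Rightarrow> ('x \<Rightarrow> real)" where
  "cadd X f g = restrict (\<lambda>x. f x + g x) (topspace X)"

definition cscale :: "'x topology \<Rightarrow> real \<Rightarrow> ('x \<Rightarrow> real) \<Rightarrow> ('x \<Rightarrow> real)" where
  "cscale X c f = restrict (\<lambda>x. c * f x) (topspace X)"

definition cone :: "'x topology \<Rightarrow> ('x \<Rightarrow> real)" where
  "cone X = restrict (\<lambda>x. 1) (topspace X)"

definition unital_positive_linear ::
    "'x topology \<Rightarrow> 'y topology \<Rightarrow> (('x \<Rightarrow> real) \<Rightarrow> ('y \<Rightarrow> real)) \<Rightarrow> bool" where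
  "unital_positive_linear X Y L \<longleftrightarrow>
     (\<forall>f\<in>cfun X. L f \<in> cfun Y) \<and>
     (\<forall>f\<in>cfun X. \<forall>g\<in>cfun X. L (cadd X f g) = cadd Y (L f) (L g)) \<and>
     (\<forall>f\<in>cfun X. \<forall>c. L (cscale X c f) = cscale Y c (L f)) \<and>
     (\<forall>f\<in>cfun X. (\<forall>x\<in>topspace X. f x \<ge> 0) \<longrightarrow> (\<forall>y\<in>topspace Y. L f y \<ge> 0)) \<and>
     L (cone X) = cone Y"

end

(* A maximal ideal m makes M totally preordered modulo m, and every homomorphism h to [0,1] obeys
   h a = (h (a + a) + h (a . a)) / 2, where modulo m one of the two terms is 0 or 1.  Iterating this
   identity from a crude start therefore converges to the homomorphism with kernel m, and the same
   doubling shows that it is unique.  Max M is the continuous image of the closed set of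
   homomorphisms in the Tychonoff cube, hence compact.

   For a point y of Max N, the map s a = (p a)^* (y) is a state: s (a + b) + s (a . b) = s a + s b.
   Writing a finite sum of elements of M as a good sequence (the truncations of the sum to the
   intervals [j, j + 1], which lie in M) shows that s is monotone on such sums, so s extends to a
   positive functional on the linear span of the functions a^*.  The span is uniformly dense in
   C(Max M): closed sets are separated by elements of M, and a continuous function with values in
   [0,1] is within 1/n of an average of n such separating elements.  Hence the extension to C(Max M)
   exists and is unique, and it is continuous in y because the approximants do not depend on y. *)

theory Submission
  imports Defs
begin

section \<open>Elementary theory of MV-algebras\<close>

text \<open>The addition of M is truncated at 1, so in general neither a^* + b^* nor an integer
  multiple of a^* is represented by an element of M; this obstacle shapes the proof. Good sequences,
  Chang's device for passing from an MV-algebra to an ordered group, record such sums inside M and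
  serve twice. In \<open>openin_star_greater\<close> they turn a^*(m) > j/n into the nonvanishing of
  a single element at m, which is all that the hull-kernel topology sees; in
  \<open>sum_good_seq\<close> they let a state be evaluated on sums. The value of a at a maximal
  ideal is not taken from an embedding theorem for Archimedean ordered groups. Working up to
  \<open>m\<close>, one doubling reads off one binary digit of the value. Linear combinations stay
  formal lists (\<open>lin_comb\<close>), so that the independence of the representation is the case
  of equality in \<open>lin_comb_state_mono\<close>.\<close>

locale mv =
  fixes pl :: "'a \<Rightarrow> 'a \<Rightarrow> 'a" (infixl "\<oplus>" 65) and ng :: "'a \<Rightarrow> 'a" and z :: 'a
  assumes mv_algebra: "mv_algebra pl ng z"
begin

definition tm :: "'a \<Rightarrow> 'a \<Rightarrow> 'a" (infixl "\<odot>" 70)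
  where "x \<odot> y = ng (ng x \<oplus> ng y)"

abbreviation le :: "'a \<Rightarrow> 'a \<Rightarrow> bool" (infix "\<preceq>" 50)
  where "x \<preceq> y \<equiv> mv_le pl ng z x y"

abbreviation meet :: "'a \<Rightarrow> 'a \<Rightarrow> 'a"
  where "meet \<equiv> mv_meet pl ng"

lemma add_assoc: "(x \<oplus> y) \<oplus> w = x \<oplus> (y \<oplus> w)"
  and add_comm: "x \<oplus> y = y \<oplus> x"
  and add_zero [simp]: "x \<oplus> z = x"
  and ng_ng [simp]: "ng (ng x) = x"
  and add_one [simp]: "x \<oplus> ng z = ng z"
  and lukasiewicz: "ng (ng x \<oplus> y) \<oplus> y = ng (ng y \<oplus> x) \<oplus> x"
  using mv_algebra unfolding mv_algebra_def by blast+

lemma add_left_comm: "x \<oplus> (y \<oplus> w) = y \<oplus> (x \<oplus> w)"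
  by (simp only: add_assoc [symmetric] add_comm [of x y])

lemma zero_add [simp]: "z \<oplus> x = x"
  by (simp add: add_comm [of z])

lemma one_add [simp]: "ng z \<oplus> x = ng z"
  by (simp add: add_comm [of "ng z"])

lemma ng_tm: "ng (x \<odot> y) = ng x \<oplus> ng y"
  by (simp add: tm_def)

lemma ng_add: "ng (x \<oplus> y) = ng x \<odot> ng y"
  by (simp add: tm_def)

lemma tm_comm: "x \<odot> y = y \<odot> x"
  by (simp add: tm_def add_comm)

lemma tm_assoc: "(x \<odot> y) \<odot> w = x \<odot> (y \<odot> w)"
  by (simp add: tm_def add_assoc)

lemma tm_left_comm: "x \<odot> (y \<odot> w) = y \<odot> (x \<odot> w)"
  by (simp only: tm_assoc [symmetric] tm_comm [of x y])

lemma tm_one [simp]: "x \<odot> ng z = x" "ng z \<odot> x = x"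
  by (simp_all add: tm_def)

lemma tm_zero [simp]: "x \<odot> z = z" "z \<odot> x = z"
  by (simp_all add: tm_def)

lemma ng_add_self [simp]: "ng x \<oplus> x = ng z" "x \<oplus> ng x = ng z"
  using lukasiewicz [of x "ng z"] by (simp_all add: add_comm [of x])

lemma tm_ng_self [simp]: "x \<odot> ng x = z" "ng x \<odot> x = z"
  by (simp_all add: tm_def)

lemma join_comm: "(x \<odot> ng y) \<oplus> y = (y \<odot> ng x) \<oplus> x"
  using lukasiewicz [of x y] by (simp add: tm_def)

lemma meet_comm: "x \<odot> (ng x \<oplus> y) = y \<odot> (ng y \<oplus> x)"
  using arg_cong [OF join_comm [of "ng x" "ng y"], of ng]
  by (simp add: tm_def add_comm [of "ng x \<odot> y"] add_comm [of "ng y"] add_comm [of _ "ng x"])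

lemma meet_eq: "meet x y = x \<odot> (ng x \<oplus> y)"
  unfolding mv_meet_def mv_join_def meet_comm [of x y]
  by (simp only: tm_def ng_ng add_comm [of x "ng y"] add_comm [of "ng (ng y \<oplus> x)" "ng y"])

lemma le_def: "x \<preceq> y \<longleftrightarrow> ng x \<oplus> y = ng z"
  by (simp add: mv_le_def)

lemma le_iff_tm: "x \<preceq> y \<longleftrightarrow> x \<odot> ng y = z"
proof
  assume "x \<odot> ng y = z"
  from arg_cong [OF this, of ng] show "x \<preceq> y"
    by (simp add: le_def tm_def)
qed (simp add: le_def tm_def)

lemma le_refl [simp]: "x \<preceq> x"
  by (simp add: le_def)

lemma le_add [simp]: "x \<preceq> x \<oplus> y" "x \<preceq> y \<oplus> x"
  by (simp_all add: le_def add_left_comm [of "ng x" y] flip: add_assoc [of "ng x" x])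

lemma join_ge: "w \<preceq> u \<oplus> (w \<odot> ng u)"
  using join_comm [of w u] by (simp add: add_comm [of u] le_add)

lemma le_antisym: "x \<preceq> y \<Longrightarrow> y \<preceq> x \<Longrightarrow> x = y"
  using lukasiewicz [of x y] by (simp add: le_def)

text \<open>\<open>y \<odot> ng x\<close> is the truncated difference y - x. The join of x and y can
  be written starting from either of them; when x lies below y, the form starting from y collapses
  to y.\<close>

lemma le_imp_add: assumes "x \<preceq> y" shows "y = x \<oplus> (y \<odot> ng x)"
  using join_comm [of x y] assms by (simp add: le_iff_tm add_comm [of x])

lemma le_trans: assumes "x \<preceq> y" "y \<preceq> w" shows "x \<preceq> w"
proof -
  have "w = x \<oplus> ((y \<odot> ng x) \<oplus> (w \<odot> ng y))"
    using le_imp_add [OF assms(1)] le_imp_add [OF assms(2)] by (simp flip: add_assoc)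
  then show ?thesis
    using le_add(1) by metis
qed

lemma ng_le_iff: "ng x \<preceq> ng y \<longleftrightarrow> y \<preceq> x"
  by (simp add: le_def add_comm [of x])

lemma residuation: "x \<odot> y \<preceq> w \<longleftrightarrow> x \<preceq> ng y \<oplus> w"
  by (simp add: le_def tm_def add_assoc)

lemma add_mono1: assumes "x \<preceq> y" shows "x \<oplus> w \<preceq> y \<oplus> w"
proof -
  have "y \<oplus> w = (x \<oplus> w) \<oplus> (y \<odot> ng x)"
    by (subst le_imp_add [OF assms]) (simp only: add_assoc add_comm [of w])
  then show ?thesis by simp
qed

lemma add_mono2: "x \<preceq> y \<Longrightarrow> w \<oplus> x \<preceq> w \<oplus> y"
  by (simp only: add_comm [of w] add_mono1)

lemma add_mono: "x \<preceq> y \<Longrightarrow> u \<preceq> w \<Longrightarrow> x \<oplus> u \<preceq> y \<oplus> w"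
  by (rule le_trans [OF add_mono1 add_mono2])

lemma tm_mono: "x \<preceq> y \<Longrightarrow> u \<preceq> w \<Longrightarrow> x \<odot> u \<preceq> y \<odot> w"
  by (simp add: tm_def ng_le_iff add_mono)

lemma tm_le [simp]: "x \<odot> y \<preceq> x" "x \<odot> y \<preceq> y"
  using ng_le_iff [of x "x \<odot> y"] ng_le_iff [of y "x \<odot> y"] by (simp_all add: ng_tm)

lemma zero_le [simp]: "z \<preceq> x" and le_one [simp]: "x \<preceq> ng z"
  by (simp_all add: le_def)

lemma le_zero [simp]: "x \<preceq> z \<longleftrightarrow> x = z"
  using le_antisym [OF _ zero_le] by auto

lemma meet_le1: "meet x y \<preceq> x" and meet_le2: "meet x y \<preceq> y"
  by (simp add: meet_eq, simp add: meet_eq meet_comm [of x])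

lemma meet_greatest: assumes "v \<preceq> x" "v \<preceq> y" shows "v \<preceq> meet x y"
proof -
  have "meet x v = v \<odot> (ng v \<oplus> x)"
    unfolding meet_eq by (rule meet_comm)
  also have "ng v \<oplus> x = ng z"
    using assms(1) unfolding le_def .
  finally have v: "meet x v = v"
    by simp
  have "x \<odot> (ng x \<oplus> v) \<preceq> x \<odot> (ng x \<oplus> y)"
    by (rule tm_mono [OF le_refl add_mono [OF le_refl assms(2)]])
  then show ?thesis
    unfolding meet_eq [symmetric] v .
qed

lemma add_meet_distrib: "v \<preceq> x \<oplus> y \<Longrightarrow> v \<preceq> x \<oplus> w \<Longrightarrow> v \<preceq> x \<oplus> meet y w"
  using meet_greatest [of "v \<odot> ng x" y w] by (simp add: residuation)

text \<open>Needed to make the set in \<open>prime\<close> closed under sums. The left side lies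
  below \<open>s \<oplus> t\<close> and, being below y, below every sum containing y;
  \<open>add_meet_distrib\<close> then replaces first t and then s by its meet with y.\<close>

lemma add_meet_le: "meet (s \<oplus> t) y \<preceq> meet s y \<oplus> meet t y"
proof -
  let ?v = "meet (s \<oplus> t) y"
  have st: "?v \<preceq> s \<oplus> t" and y: "?v \<preceq> y"
    by (simp_all add: meet_le1 meet_le2)
  have yw: "?v \<preceq> y \<oplus> w" "?v \<preceq> w \<oplus> y" for w
    using y le_trans le_add by blast+
  have 1: "?v \<preceq> s \<oplus> meet t y"
    using add_meet_distrib st yw by blast
  have 2: "?v \<preceq> y \<oplus> meet t y"
    using yw by blast
  show ?thesis
    using add_meet_distrib [of ?v "meet t y" s y] 1 2 by (simp add: add_comm)
qed

lemma tm_add_le: "x \<odot> (y \<oplus> w) \<preceq> (x \<odot> y) \<oplus> w"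
proof -
  have "y \<preceq> ng x \<oplus> (x \<odot> y)"
    using residuation [of y x "x \<odot> y"] by (simp add: tm_comm [of y])
  then have "y \<oplus> w \<preceq> ng x \<oplus> ((x \<odot> y) \<oplus> w)"
    by (simp add: add_mono1 flip: add_assoc)
  then show ?thesis
    by (simp add: residuation tm_comm [of x])
qed

text \<open>Adding \<open>?v\<close> to the meet \<open>?m\<close> of a and b stays below both a and
  b, so it does not exceed \<open>?m\<close>. As \<open>?v\<close> is also disjoint from
  \<open>?m\<close>, that is below \<open>ng ?m\<close>, it must be zero.\<close>

lemma prelinear: "meet (a \<odot> ng b) (b \<odot> ng a) = z"
proof -
  let ?v = "meet (a \<odot> ng b) (b \<odot> ng a)" and ?m = "meet a b"
  have "a \<odot> ng b \<preceq> a \<odot> ng ?m" "b \<odot> ng a \<preceq> b \<odot> ng ?m"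
    by (simp_all add: tm_mono ng_le_iff meet_le1 meet_le2)
  then have va: "?v \<preceq> a \<odot> ng ?m" and vb: "?v \<preceq> b \<odot> ng ?m"
    using le_trans meet_le1 meet_le2 by blast+
  have "?m \<oplus> ?v \<preceq> a"
    using add_mono2 [OF va, of ?m] le_imp_add [OF meet_le1 [of a b]] by simp
  moreover have "?m \<oplus> ?v \<preceq> b"
    using add_mono2 [OF vb, of ?m] le_imp_add [OF meet_le2 [of a b]] by simp
  ultimately have "?m \<oplus> ?v \<preceq> ?m"
    using meet_greatest by blast
  from tm_mono [OF le_refl this, of "ng ?m"] have "ng ?m \<odot> (?m \<oplus> ?v) = z"
    by simp
  moreover have "?v \<preceq> ng ?m"
    using va le_trans tm_le(2) by blast
  then have "?v \<preceq> meet (ng ?m) ?v"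
    using meet_greatest by simp
  ultimately show ?thesis
    by (simp add: meet_eq)
qed

end

section \<open>Arithmetic modulo a maximal ideal\<close>

locale mv_max = mv +
  fixes m assumes maximal: "mv_maximal_ideal pl ng z m"
begin

lemma ideal: "mv_ideal pl ng z m" and proper: "m \<noteq> UNIV"
  and maximal_eq: "\<And>J. mv_ideal pl ng z J \<Longrightarrow> m \<subseteq> J \<Longrightarrow> J = m \<or> J = UNIV"
  using maximal unfolding mv_maximal_ideal_def by auto

lemma zero_in [simp]: "z \<in> m"
  and add_in: "x \<in> m \<Longrightarrow> y \<in> m \<Longrightarrow> x \<oplus> y \<in> m"
  and down: "y \<preceq> x \<Longrightarrow> x \<in> m \<Longrightarrow> y \<in> m"
  using ideal unfolding mv_ideal_def by auto

lemma add_in_iff [simp]: "x \<oplus> y \<in> m \<longleftrightarrow> x \<in> m \<and> y \<in> m"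
  using add_in down le_add by blast

lemma tm_in: "x \<in> m \<Longrightarrow> x \<odot> y \<in> m" "y \<in> m \<Longrightarrow> x \<odot> y \<in> m"
  using down tm_le by blast+

lemma one_notin [simp]: "ng z \<notin> m"
  using proper down le_one by blast

lemma not_both: "x \<in> m \<Longrightarrow> ng x \<notin> m"
  using add_in [of x "ng x"] by auto

text \<open>The set of all \<open>t\<close> with \<open>t \<and> y \<in> m\<close> is an ideal above \<open>m\<close>, so it is \<open>m\<close> or everything.\<close>

lemma prime: assumes "meet x y \<in> m" shows "x \<in> m \<or> y \<in> m"
proof -
  let ?J = "{t. meet t y \<in> m}"
  have "mv_ideal pl ng z ?J"
    unfolding mv_ideal_def
  proof (intro conjI ballI allI impI)
    show "z \<in> ?J"
      using down [OF meet_le1] by simp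
    show "a \<oplus> b \<in> ?J" if "a \<in> ?J" "b \<in> ?J" for a b
      using down [OF add_meet_le add_in] that by simp
    show "b \<in> ?J" if "a \<in> ?J" "b \<preceq> a" for a b
      using down [OF meet_greatest [OF le_trans [OF meet_le1] meet_le2]] that by simp
  qed
  moreover have "m \<subseteq> ?J"
    using down [OF meet_le1] by auto
  ultimately have "?J = m \<or> ?J = UNIV"
    by (rule maximal_eq)
  then show ?thesis
  proof
    assume "?J = m" then show ?thesis using assms by blast
  next
    assume "?J = UNIV"
    then have "meet (ng z) y \<in> m" by auto
    then show ?thesis by (simp add: meet_eq)
  qed
qed

text \<open>The order of the quotient M/m, which is never formed: equality in the quotient is
  \<open>mle\<close> in both directions.\<close>

definition mle :: "'a \<Rightarrow> 'a \<Rightarrow> bool" (infix "\<sqsubseteq>" 50)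
  where "x \<sqsubseteq> y \<longleftrightarrow> x \<odot> ng y \<in> m"

lemma mle_total: "x \<sqsubseteq> y \<or> y \<sqsubseteq> x"
  unfolding mle_def by (rule prime) (simp add: prelinear)

lemma le_imp_mle: "x \<preceq> y \<Longrightarrow> x \<sqsubseteq> y"
  by (simp add: mle_def le_iff_tm)

lemma mle_residuation: "x \<odot> y \<sqsubseteq> w \<longleftrightarrow> x \<sqsubseteq> ng y \<oplus> w"
  unfolding mle_def by (simp add: ng_add tm_assoc)

text \<open>The truncated difference of x and y is the least possible witness i. In this form
  transitivity and compatibility with sums reduce to closure of \<open>m\<close> under
  addition.\<close>

lemma mle_iff: "x \<sqsubseteq> y \<longleftrightarrow> (\<exists>i\<in>m. x \<preceq> y \<oplus> i)"
proof
  assume "x \<sqsubseteq> y"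
  moreover have "x \<preceq> y \<oplus> (x \<odot> ng y)"
    by (rule join_ge)
  ultimately show "\<exists>i\<in>m. x \<preceq> y \<oplus> i"
    unfolding mle_def by blast
next
  assume "\<exists>i\<in>m. x \<preceq> y \<oplus> i"
  then obtain i where "i \<in> m" "x \<odot> ng y \<preceq> i"
    using residuation by auto
  then show "x \<sqsubseteq> y"
    unfolding mle_def using down by blast
qed

lemma mle_refl [simp]: "x \<sqsubseteq> x"
  by (simp add: le_imp_mle)

lemma mle_trans [trans]: assumes "x \<sqsubseteq> y" "y \<sqsubseteq> w" shows "x \<sqsubseteq> w"
proof -
  obtain i j where "i \<in> m" "x \<preceq> y \<oplus> i" "j \<in> m" "y \<preceq> w \<oplus> j"
    using assms by (auto simp: mle_iff)
  then have "x \<preceq> w \<oplus> (j \<oplus> i)" "j \<oplus> i \<in> m"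
    using le_trans [OF _ add_mono1, of x y i "w \<oplus> j"] by (simp_all add: add_assoc)
  then show ?thesis by (auto simp: mle_iff)
qed

lemma mle_add1: assumes "x \<sqsubseteq> y" shows "x \<oplus> w \<sqsubseteq> y \<oplus> w"
proof -
  obtain i where "i \<in> m" "x \<preceq> y \<oplus> i"
    using assms by (auto simp: mle_iff)
  then have "x \<oplus> w \<preceq> (y \<oplus> w) \<oplus> i"
    using add_mono1 [of x "y \<oplus> i" w] by (simp add: add_assoc add_comm [of i])
  then show ?thesis using \<open>i \<in> m\<close> by (auto simp: mle_iff)
qed

lemma mle_add: "x \<sqsubseteq> y \<Longrightarrow> u \<sqsubseteq> w \<Longrightarrow> x \<oplus> u \<sqsubseteq> y \<oplus> w"
  using mle_trans [OF mle_add1 [of x y u]] mle_add1 [of u w y] by (simp add: add_comm [of y])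

lemma mle_ng: "x \<sqsubseteq> y \<Longrightarrow> ng y \<sqsubseteq> ng x"
  by (simp add: mle_def tm_comm)

lemma mle_ng_iff: "ng x \<sqsubseteq> ng y \<longleftrightarrow> y \<sqsubseteq> x"
  using mle_ng [of x y] mle_ng [of "ng x" "ng y"] mle_ng [of y x] by auto

lemma mle_tm: "x \<sqsubseteq> y \<Longrightarrow> u \<sqsubseteq> w \<Longrightarrow> x \<odot> u \<sqsubseteq> y \<odot> w"
  by (simp add: tm_def mle_add mle_ng)

lemma in_iff_mle: "x \<in> m \<longleftrightarrow> x \<sqsubseteq> z"
  by (simp add: mle_def)

lemma mle_in: "x \<sqsubseteq> y \<Longrightarrow> y \<in> m \<Longrightarrow> x \<in> m"
  using in_iff_mle mle_trans by blast

lemma tm_in_iff: "x \<odot> y \<in> m \<longleftrightarrow> x \<sqsubseteq> ng y"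
  by (simp add: mle_def)

lemma ng_add_in_iff: "ng (x \<oplus> y) \<in> m \<longleftrightarrow> ng x \<sqsubseteq> y"
  by (simp add: mle_def ng_add)

text \<open>Totality applied to a and \<open>ng a\<close>: modulo \<open>m\<close>, a is at most or
  at least one half. This decides the next binary digit.\<close>

lemma half: "a \<odot> a \<in> m \<or> ng (a \<oplus> a) \<in> m"
  using mle_total by (auto simp: tm_in_iff ng_add_in_iff)

lemma join_mle: assumes "u \<sqsubseteq> w" shows "u \<oplus> (w \<odot> ng u) \<sqsubseteq> w"
proof -
  have "u \<oplus> (w \<odot> ng u) = w \<oplus> (u \<odot> ng w)"
    using join_comm [of w u] by (simp only: add_comm)
  moreover have "w \<oplus> (u \<odot> ng w) \<sqsubseteq> w"
    unfolding mle_iff using assms [unfolded mle_def] le_refl by blast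
  ultimately show ?thesis by simp
qed

text \<open>A converse of \<open>tm_add_le\<close> where nothing is truncated: with y + w at least 1
  and x + y at most 1, both sides are x + y + w - 1. The left side \<open>?v\<close> lies below w,
  hence equals the meet of w and \<open>?v\<close>, and \<open>ng w \<oplus> ?v\<close> is at most
  \<open>x \<oplus> y\<close>.\<close>

lemma add_tm_mle: assumes "ng w \<sqsubseteq> y" "x \<sqsubseteq> ng y"
  shows "x \<oplus> (y \<odot> w) \<sqsubseteq> (x \<oplus> y) \<odot> w"
proof -
  let ?v = "x \<oplus> (y \<odot> w)"
  have "?v \<sqsubseteq> ng y \<oplus> (y \<odot> w)"
    using assms(2) mle_add1 by blast
  also have "\<dots> \<sqsubseteq> w"
    using join_mle [of "ng y" w] mle_ng [OF assms(1)] by (simp add: tm_comm)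
  finally have "?v \<sqsubseteq> w" .
  then have "ng z \<sqsubseteq> ng ?v \<oplus> w"
    using mle_residuation [of "ng z" ?v w] by simp
  from mle_tm [OF mle_refl this, of ?v] have "?v \<sqsubseteq> w \<odot> (ng w \<oplus> ?v)"
    by (simp add: meet_comm [of ?v])
  moreover
  have "ng w \<oplus> (y \<odot> w) \<sqsubseteq> y"
    using join_mle [of "ng w" y] assms(1) by simp
  then have "ng w \<oplus> ?v \<sqsubseteq> x \<oplus> y"
    using mle_add [OF mle_refl, of _ y x] by (simp add: add_left_comm [of _ x])
  from mle_tm [OF mle_refl this] have "w \<odot> (ng w \<oplus> ?v) \<sqsubseteq> w \<odot> (x \<oplus> y)" .
  ultimately show ?thesis
    unfolding tm_comm [of "x \<oplus> y"] by (rule mle_trans)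
qed

section \<open>The homomorphism of a maximal ideal\<close>

text \<open>Modulo \<open>m\<close> one of the two summands is \<open>0\<close> or \<open>1\<close>, so each step halves the error.\<close>

primrec dyadic_hom :: "nat \<Rightarrow> 'a \<Rightarrow> real" where
  "dyadic_hom 0 a = (if a \<in> m then 0 else if ng a \<in> m then 1 else 1/2)"
| "dyadic_hom (Suc n) a = (dyadic_hom n (a \<oplus> a) + dyadic_hom n (a \<odot> a)) / 2"

lemma dyadic_hom_in: "a \<in> m \<Longrightarrow> dyadic_hom n a = 0"
  by (induction n arbitrary: a) (simp_all add: tm_in)

lemma dyadic_hom_ng: "dyadic_hom n (ng a) = 1 - dyadic_hom n a"
proof (induction n arbitrary: a)
  case 0
  then show ?case using not_both [of a] by auto
next
  case (Suc n)
  have "dyadic_hom n (ng a \<oplus> ng a) = 1 - dyadic_hom n (a \<odot> a)" "dyadic_hom n (ng a \<odot> ng a) = 1 - dyadic_hom n (a \<oplus> a)"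
    by (simp_all add: Suc [symmetric] ng_tm ng_add)
  then show ?case by (simp add: field_simps)
qed

lemma dyadic_hom_ng_in: "ng a \<in> m \<Longrightarrow> dyadic_hom n a = 1"
  using dyadic_hom_ng [of n a] dyadic_hom_in by force

lemma dyadic_hom_bounds: "0 \<le> dyadic_hom n a" "dyadic_hom n a \<le> 1"
proof -
  have "0 \<le> dyadic_hom n a \<and> dyadic_hom n a \<le> 1"
  proof (induction n arbitrary: a)
    case (Suc n)
    show ?case using Suc [of "a \<oplus> a"] Suc [of "a \<odot> a"] by simp
  qed simp
  then show "0 \<le> dyadic_hom n a" "dyadic_hom n a \<le> 1" by auto
qed

lemma dyadic_hom_cong: "a \<sqsubseteq> b \<Longrightarrow> b \<sqsubseteq> a \<Longrightarrow> dyadic_hom n a = dyadic_hom n b"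
proof (induction n arbitrary: a b)
  case 0
  then have "a \<in> m \<longleftrightarrow> b \<in> m" "ng a \<in> m \<longleftrightarrow> ng b \<in> m"
    using mle_in mle_ng by blast+
  then show ?case by simp
next
  case (Suc n)
  then show ?case
    by (simp add: Suc.IH [of "a \<oplus> a" "b \<oplus> b"] Suc.IH [of "a \<odot> a" "b \<odot> b"] mle_add mle_tm)
qed

text \<open>With \<open>c = 1 - a - b\<close> and \<open>d = b - a\<close>, this is \<open>(1 - 2 a) + (1 - 2 b) = (c + d) + (c - d) = 2 c\<close>.\<close>

lemma square_sum_equiv:
  assumes "a \<odot> b \<in> m" "b \<odot> b \<in> m" "a \<sqsubseteq> b"
  shows "(a \<oplus> a) \<odot> (b \<oplus> b) \<sqsubseteq> (a \<oplus> b) \<odot> (a \<oplus> b)"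
    and "(a \<oplus> b) \<odot> (a \<oplus> b) \<sqsubseteq> (a \<oplus> a) \<odot> (b \<oplus> b)"
proof -
  define c d where "c = ng a \<odot> ng b" and "d = b \<odot> ng a"
  have d: "d \<oplus> ng b \<sqsubseteq> ng a" "ng a \<preceq> d \<oplus> ng b"
  proof -
    have eq: "d \<oplus> ng b = ng b \<oplus> (ng a \<odot> ng (ng b))"
      by (simp add: d_def add_comm tm_comm)
    show "d \<oplus> ng b \<sqsubseteq> ng a"
      unfolding eq using assms(3) by (intro join_mle mle_ng)
    show "ng a \<preceq> d \<oplus> ng b"
      unfolding eq by (rule join_ge)
  qed
  have dnb: "d \<sqsubseteq> ng (ng b)"
    unfolding d_def by (simp add: le_imp_mle)
  have bb: "b \<sqsubseteq> ng b"
    using assms(2) by (simp add: tm_in_iff)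
  have ab: "a \<sqsubseteq> ng b"
    using assms(1) by (simp add: tm_in_iff)
  \<comment> \<open>Facts 1 and 4 say 1 - 2b = c - d in the subtraction-free form c = d + (1 - 2b);
    facts 2 and 3 say 1 - 2a = c + d. The claim is then proved for the complements of both
    sides.\<close>
  have 1: "c \<sqsubseteq> d \<oplus> (ng b \<odot> ng b)"
  proof -
    have "c \<preceq> ng b \<odot> (d \<oplus> ng b)"
      unfolding c_def tm_comm [of "ng a"] by (intro tm_mono le_refl d)
    also have "\<dots> = ng b \<odot> (ng b \<oplus> d)"
      by (simp add: add_comm)
    also have "\<dots> \<preceq> (ng b \<odot> ng b) \<oplus> d"
      by (rule tm_add_le)
    finally (le_trans) show ?thesis
      by (simp add: le_imp_mle add_comm)
  qed
  have 2: "c \<oplus> d \<sqsubseteq> ng a \<odot> ng a"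
  proof -
    have "d \<oplus> (ng b \<odot> ng a) \<sqsubseteq> (d \<oplus> ng b) \<odot> ng a"
      by (rule add_tm_mle) (use ab dnb in simp_all)
    also have "\<dots> \<sqsubseteq> ng a \<odot> ng a"
      using d(1) by (simp add: mle_tm)
    finally show ?thesis
      by (simp add: c_def tm_comm add_comm)
  qed
  have 3: "ng a \<odot> ng a \<sqsubseteq> c \<oplus> d"
  proof -
    have "ng a \<preceq> b \<oplus> (ng a \<odot> ng b)"
      by (rule join_ge)
    then have "ng a \<odot> ng a \<preceq> ng a \<odot> (b \<oplus> c)"
      unfolding c_def by (intro tm_mono le_refl)
    also have "ng a \<odot> (b \<oplus> c) \<preceq> (ng a \<odot> b) \<oplus> c"
      by (rule tm_add_le)
    finally (le_trans) show ?thesis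
      by (simp add: d_def tm_comm add_comm le_imp_mle)
  qed
  have 4: "d \<oplus> (ng b \<odot> ng b) \<sqsubseteq> c"
  proof -
    have "d \<oplus> (ng b \<odot> ng b) \<sqsubseteq> (d \<oplus> ng b) \<odot> ng b"
      by (rule add_tm_mle) (use bb dnb in simp_all)
    also have "\<dots> \<sqsubseteq> c"
      unfolding c_def using d(1) by (simp add: mle_tm)
    finally show ?thesis .
  qed
  have eqs: "ng ((a \<oplus> a) \<odot> (b \<oplus> b)) = (ng a \<odot> ng a) \<oplus> (ng b \<odot> ng b)"
      "ng ((a \<oplus> b) \<odot> (a \<oplus> b)) = c \<oplus> c"
    by (simp_all add: ng_tm ng_add c_def)
  have "c \<oplus> c \<sqsubseteq> c \<oplus> (d \<oplus> (ng b \<odot> ng b))"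
    using 1 by (simp add: mle_add)
  also have "\<dots> \<sqsubseteq> (ng a \<odot> ng a) \<oplus> (ng b \<odot> ng b)"
    using mle_add1 [OF 2, of "ng b \<odot> ng b"] by (simp add: add_assoc)
  finally show "(a \<oplus> a) \<odot> (b \<oplus> b) \<sqsubseteq> (a \<oplus> b) \<odot> (a \<oplus> b)"
    unfolding eqs [symmetric] by (simp add: mle_ng_iff)
  have "(ng a \<odot> ng a) \<oplus> (ng b \<odot> ng b) \<sqsubseteq> c \<oplus> (d \<oplus> (ng b \<odot> ng b))"
    using mle_add1 [OF 3, of "ng b \<odot> ng b"] by (simp add: add_assoc)
  also have "\<dots> \<sqsubseteq> c \<oplus> c"
    using 4 by (simp add: mle_add)
  finally show "(a \<oplus> b) \<odot> (a \<oplus> b) \<sqsubseteq> (a \<oplus> a) \<odot> (b \<oplus> b)"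
    unfolding eqs [symmetric] by (simp add: mle_ng_iff)
qed

text \<open>The doubling step when a is at least one half: 2(a + b) - 1 = (2a - 1) + 2b, and these
  two summands again add up to at most 1 because a + b does.\<close>

lemma square_add_cong:
  assumes ab: "a \<odot> b \<in> m" and a: "ng (a \<oplus> a) \<in> m"
  shows "b \<odot> b \<in> m" "(a \<odot> a) \<odot> (b \<oplus> b) \<in> m"
    "(a \<oplus> b) \<odot> (a \<oplus> b) \<sqsubseteq> (a \<odot> a) \<oplus> (b \<oplus> b)"
    "(a \<odot> a) \<oplus> (b \<oplus> b) \<sqsubseteq> (a \<oplus> b) \<odot> (a \<oplus> b)"
proof -
  have na: "ng a \<sqsubseteq> a"
    using a by (simp add: ng_add_in_iff)
  have ba: "b \<sqsubseteq> ng a"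
    using ab by (simp add: tm_comm [of a] flip: tm_in_iff)
  have "b \<sqsubseteq> ng b"
    using mle_trans [OF ba mle_trans [OF na]] ab by (simp add: tm_in_iff)
  then show "b \<odot> b \<in> m"
    by (simp add: tm_in_iff)
  have "b \<odot> a \<in> m"
    using ab by (simp add: tm_comm)
  have "a \<odot> (b \<oplus> b) \<preceq> (a \<odot> b) \<oplus> b"
    by (rule tm_add_le)
  then have "a \<odot> (a \<odot> (b \<oplus> b)) \<preceq> a \<odot> (b \<oplus> (a \<odot> b))"
    unfolding add_comm [of b "a \<odot> b"] by (intro tm_mono le_refl)
  also have "\<dots> \<preceq> (a \<odot> b) \<oplus> (a \<odot> b)"
    by (rule tm_add_le)
  finally (le_trans) show "(a \<odot> a) \<odot> (b \<oplus> b) \<in> m"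
    using down [of "a \<odot> a \<odot> (b \<oplus> b)"] ab by (simp add: tm_assoc)
  have "(a \<oplus> b) \<odot> (a \<oplus> b) \<preceq> ((a \<oplus> b) \<odot> a) \<oplus> b"
    by (rule tm_add_le)
  moreover have "a \<odot> (a \<oplus> b) \<preceq> (a \<odot> a) \<oplus> b"
    by (rule tm_add_le)
  ultimately have "(a \<oplus> b) \<odot> (a \<oplus> b) \<preceq> ((a \<odot> a) \<oplus> b) \<oplus> b"
    unfolding tm_comm [of "a \<oplus> b" a] by (rule le_trans [OF _ add_mono1])
  then show "(a \<oplus> b) \<odot> (a \<oplus> b) \<sqsubseteq> (a \<odot> a) \<oplus> (b \<oplus> b)"
    using le_imp_mle by (simp add: add_assoc)
  have "b \<oplus> (a \<odot> a) \<sqsubseteq> (b \<oplus> a) \<odot> a"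
    by (rule add_tm_mle [OF na ba])
  then have "b \<oplus> (b \<oplus> (a \<odot> a)) \<sqsubseteq> b \<oplus> (a \<odot> (a \<oplus> b))"
    unfolding add_comm [of a b] tm_comm [of a "b \<oplus> a"] by (intro mle_add mle_refl)
  also have "\<dots> \<sqsubseteq> (b \<oplus> a) \<odot> (a \<oplus> b)"
  proof (rule add_tm_mle [OF _ ba])
    have "ng (a \<oplus> b) \<preceq> ng a"
      by (simp add: ng_le_iff)
    then show "ng (a \<oplus> b) \<sqsubseteq> a"
      using mle_trans [OF le_imp_mle na] by blast
  qed
  finally show "(a \<odot> a) \<oplus> (b \<oplus> b) \<sqsubseteq> (a \<oplus> b) \<odot> (a \<oplus> b)"
    by (simp add: add_comm [of "a \<odot> a" "b \<oplus> b"] add_comm [of a b] add_assoc)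
qed

text \<open>The hypothesis says that a + b is at most one half. The first conclusion is
  \<open>square_sum_equiv\<close>, which wants the smaller element first; hence the split by
  totality.\<close>

lemma double_orthogonal:
  assumes w: "(a \<oplus> b) \<odot> (a \<oplus> b) \<in> m"
  shows "(a \<oplus> a) \<odot> (b \<oplus> b) \<in> m" "a \<odot> a \<in> m" "b \<odot> b \<in> m"
proof -
  show aa: "a \<odot> a \<in> m" and bb: "b \<odot> b \<in> m"
    using down [OF tm_mono [OF le_add(1) le_add(1)] w] down [OF tm_mono [OF le_add(2) le_add(2)] w]
    by blast+
  have ab: "a \<odot> b \<in> m"
    by (rule down [OF tm_mono [OF le_add(1) le_add(2)] w])
  then have ba: "b \<odot> a \<in> m"
    by (simp add: tm_comm)
  show "(a \<oplus> a) \<odot> (b \<oplus> b) \<in> m"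
  proof (cases "a \<sqsubseteq> b")
    case True
    then show ?thesis
      using square_sum_equiv(1) [OF ab bb] w mle_in by blast
  next
    case False
    then have "b \<sqsubseteq> a" using mle_total by blast
    then have "(b \<oplus> b) \<odot> (a \<oplus> a) \<in> m"
      using mle_in [OF square_sum_equiv(1) [OF ba aa]] w by (simp add: add_comm [of b a])
    then show ?thesis by (simp add: tm_comm)
  qed
qed

lemma square_cong:
  assumes "a \<odot> b \<in> m" "a \<odot> a \<in> m" "b \<odot> b \<in> m"
  shows "dyadic_hom n ((a \<oplus> b) \<odot> (a \<oplus> b)) = dyadic_hom n ((a \<oplus> a) \<odot> (b \<oplus> b))"
proof (cases "a \<sqsubseteq> b")
  case True
  then show ?thesis
    using square_sum_equiv [OF assms(1) assms(3)] by (intro dyadic_hom_cong)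
next
  case False
  then have "b \<sqsubseteq> a" using mle_total by blast
  moreover have "b \<odot> a \<in> m"
    using assms(1) by (simp add: tm_comm)
  ultimately have "dyadic_hom n ((b \<oplus> a) \<odot> (b \<oplus> a)) = dyadic_hom n ((b \<oplus> b) \<odot> (a \<oplus> a))"
    using square_sum_equiv [OF _ assms(2)] by (intro dyadic_hom_cong)
  then show ?thesis by (simp add: add_comm [of b a] tm_comm [of "b \<oplus> b" "a \<oplus> a"])
qed

text \<open>Doubling replaces a, b by a pair that is again orthogonal modulo \<open>m\<close>:
  \<open>a \<odot> a\<close>, \<open>b \<oplus> b\<close> if a is at least one half (symmetrically
  for b), \<open>a \<oplus> a\<close>, \<open>b \<oplus> b\<close> if the sum is at most one half,
  and the complements of the latter two otherwise. Averaging halves the error. The constant 2 is the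
  trivial bound at n = 0 for values between 0 and 1.\<close>

lemma dyadic_hom_add:
  "a \<odot> b \<in> m \<Longrightarrow> \<bar>dyadic_hom n (a \<oplus> b) - dyadic_hom n a - dyadic_hom n b\<bar> \<le> 2 / 2 ^ n"
proof (induction n arbitrary: a b)
  case 0
  then show ?case by auto
next
  case (Suc n)
  define d :: real where "d = 2 / 2 ^ n"
  have d_Suc: "2 / 2 ^ Suc n = d / 2"
    by (simp add: d_def)
  note IH = Suc.IH [folded d_def]
  have large: "\<bar>dyadic_hom (Suc n) (a \<oplus> b) - dyadic_hom (Suc n) a - dyadic_hom (Suc n) b\<bar> \<le> 2 / 2 ^ Suc n"
    if ab: "a \<odot> b \<in> m" and a: "ng (a \<oplus> a) \<in> m" for a b
  proof -
    note * = square_add_cong [OF ab a]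
    have "ng ((a \<oplus> b) \<oplus> (a \<oplus> b)) \<preceq> ng (a \<oplus> a)"
      by (simp add: ng_le_iff add_mono)
    then have "dyadic_hom n ((a \<oplus> b) \<oplus> (a \<oplus> b)) = 1"
      using a down dyadic_hom_ng_in by blast
    moreover have "dyadic_hom n (a \<oplus> a) = 1" "dyadic_hom n (b \<odot> b) = 0"
      using a dyadic_hom_ng_in dyadic_hom_in *(1) by auto
    moreover have "dyadic_hom n ((a \<oplus> b) \<odot> (a \<oplus> b)) = dyadic_hom n ((a \<odot> a) \<oplus> (b \<oplus> b))"
      using *(3,4) by (rule dyadic_hom_cong)
    ultimately have eq: "dyadic_hom (Suc n) (a \<oplus> b) - dyadic_hom (Suc n) a - dyadic_hom (Suc n) b =
        (dyadic_hom n ((a \<odot> a) \<oplus> (b \<oplus> b)) - dyadic_hom n (a \<odot> a) - dyadic_hom n (b \<oplus> b)) / 2"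
      by (simp add: field_simps)
    then show ?thesis
      unfolding eq d_Suc using IH [OF *(2)] by simp
  qed
  consider "ng (a \<oplus> a) \<in> m" | "ng (b \<oplus> b) \<in> m" | "a \<odot> a \<in> m" "b \<odot> b \<in> m"
    using half by blast
  then show ?case
  proof cases
    case 1
    then show ?thesis using large Suc.prems by blast
  next
    case 2
    have "b \<odot> a \<in> m" using Suc.prems by (simp add: tm_comm)
    from large [OF this 2] show ?thesis
      unfolding add_comm [of a b] by linarith
  next
    case 3
    consider "(a \<oplus> b) \<odot> (a \<oplus> b) \<in> m" | "ng ((a \<oplus> b) \<oplus> (a \<oplus> b)) \<in> m"
      using half by blast
    then show ?thesis
    proof cases
      case 1
      have "(a \<oplus> b) \<oplus> (a \<oplus> b) = (a \<oplus> a) \<oplus> (b \<oplus> b)"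
        by (simp add: add_assoc add_left_comm)
      moreover have "dyadic_hom n (a \<odot> a) = 0" "dyadic_hom n (b \<odot> b) = 0" "dyadic_hom n ((a \<oplus> b) \<odot> (a \<oplus> b)) = 0"
        using 3 1 by (simp_all add: dyadic_hom_in)
      ultimately have eq: "dyadic_hom (Suc n) (a \<oplus> b) - dyadic_hom (Suc n) a - dyadic_hom (Suc n) b =
          (dyadic_hom n ((a \<oplus> a) \<oplus> (b \<oplus> b)) - dyadic_hom n (a \<oplus> a) - dyadic_hom n (b \<oplus> b)) / 2"
        by (simp add: field_simps)
      then show ?thesis
        unfolding eq d_Suc using IH [OF double_orthogonal(1) [OF 1]] by simp
    next
      case 2
      \<comment> \<open>The doubles of a and b now add up to at least 1, so \<open>IH\<close> does
        not apply to them, but their complements add up to at most 1.\<close>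
      have "ng ((a \<oplus> b) \<oplus> (a \<oplus> b)) = ng (a \<oplus> a) \<odot> ng (b \<oplus> b)"
        by (simp add: ng_add tm_assoc tm_left_comm)
      then have le: "\<bar>dyadic_hom n (ng (a \<oplus> a) \<oplus> ng (b \<oplus> b)) - dyadic_hom n (ng (a \<oplus> a)) - dyadic_hom n (ng (b \<oplus> b))\<bar> \<le> d"
        using IH 2 by simp
      have "dyadic_hom n (ng (a \<oplus> a) \<oplus> ng (b \<oplus> b)) = 1 - dyadic_hom n ((a \<oplus> b) \<odot> (a \<oplus> b))"
        using square_cong [OF Suc.prems 3] by (simp add: dyadic_hom_ng flip: ng_tm)
      moreover have "dyadic_hom n (a \<odot> a) = 0" "dyadic_hom n (b \<odot> b) = 0" "dyadic_hom n ((a \<oplus> b) \<oplus> (a \<oplus> b)) = 1"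
        using 3 2 by (simp_all add: dyadic_hom_in dyadic_hom_ng_in)
      ultimately have eq: "dyadic_hom (Suc n) (a \<oplus> b) - dyadic_hom (Suc n) a - dyadic_hom (Suc n) b =
          - (dyadic_hom n (ng (a \<oplus> a) \<oplus> ng (b \<oplus> b)) - dyadic_hom n (ng (a \<oplus> a)) - dyadic_hom n (ng (b \<oplus> b))) / 2"
        by (simp add: dyadic_hom_ng field_simps)
      then show ?thesis
        unfolding eq d_Suc using le by simp
    qed
  qed
qed

text \<open>By \<open>half\<close> one of the two averaged terms is constantly 0 or constantly 1, so
  only the other one moves and the change is halved.\<close>

lemma dyadic_hom_Suc_diff: "\<bar>dyadic_hom (Suc n) a - dyadic_hom n a\<bar> \<le> 1 / 2 ^ n"
proof (induction n arbitrary: a)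
  case 0
  show ?case using dyadic_hom_bounds [of 1 a] dyadic_hom_bounds [of 0 a] by (simp del: dyadic_hom.simps add: abs_if)
next
  case (Suc n)
  define d :: real where "d = 1 / 2 ^ n"
  have d_Suc: "1 / 2 ^ Suc n = d / 2"
    by (simp add: d_def)
  note IH = Suc [folded d_def]
  have eq: "dyadic_hom (Suc k) a = (dyadic_hom k (a \<oplus> a) + dyadic_hom k (a \<odot> a)) / 2" for k
    by simp
  from half [of a] show ?case
  proof
    assume "a \<odot> a \<in> m"
    then show ?thesis
      using IH [of "a \<oplus> a"] unfolding eq [of n] eq [of "Suc n"] d_Suc
      by (simp del: dyadic_hom.simps add: dyadic_hom_in flip: diff_divide_distrib)
  next
    assume "ng (a \<oplus> a) \<in> m"
    then show ?thesis
      using IH [of "a \<odot> a"] unfolding eq [of n] eq [of "Suc n"] d_Suc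
      by (simp del: dyadic_hom.simps add: dyadic_hom_ng_in flip: diff_divide_distrib)
  qed
qed

definition hom :: "'a \<Rightarrow> real"
  where "hom a = lim (\<lambda>n. dyadic_hom n a)"

lemma dyadic_hom_tendsto: "(\<lambda>n. dyadic_hom n a) \<longlonglongrightarrow> hom a"
proof -
  have "summable (\<lambda>n. dyadic_hom (Suc n) a - dyadic_hom n a)"
  proof (rule summable_comparison_test')
    show "summable (\<lambda>n. (1/2::real) ^ n)"
      by (simp add: summable_geometric)
    show "norm (dyadic_hom (Suc n) a - dyadic_hom n a) \<le> (1/2) ^ n" for n
      using dyadic_hom_Suc_diff [of n a] by (simp del: dyadic_hom.simps add: power_one_over)
  qed
  then have "convergent (\<lambda>n. \<Sum>k<n. dyadic_hom (Suc k) a - dyadic_hom k a)"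
    by (simp add: summable_iff_convergent)
  then have "convergent (\<lambda>n. dyadic_hom n a - dyadic_hom 0 a)"
    by (simp only: sum_lessThan_telescope [where f = "\<lambda>k. dyadic_hom k a"])
  then have "convergent (\<lambda>n. (dyadic_hom n a - dyadic_hom 0 a) + dyadic_hom 0 a)"
    using convergent_add [OF _ convergent_const] by blast
  then show ?thesis
    unfolding hom_def convergent_LIMSEQ_iff by simp
qed

lemma hom_bounds: "0 \<le> hom a" "hom a \<le> 1"
  using LIMSEQ_le_const [OF dyadic_hom_tendsto] LIMSEQ_le_const2 [OF dyadic_hom_tendsto] dyadic_hom_bounds by blast+

lemma hom_in: "a \<in> m \<Longrightarrow> hom a = 0"
  using dyadic_hom_tendsto [of a] by (simp add: dyadic_hom_in LIMSEQ_const_iff)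

lemma hom_ng: "hom (ng a) = 1 - hom a"
proof -
  have "(\<lambda>n. dyadic_hom n (ng a)) \<longlonglongrightarrow> 1 - hom a"
    unfolding dyadic_hom_ng by (intro tendsto_intros dyadic_hom_tendsto)
  then show ?thesis
    using dyadic_hom_tendsto LIMSEQ_unique by blast
qed

lemma hom_add: assumes "a \<odot> b \<in> m" shows "hom (a \<oplus> b) = hom a + hom b"
proof -
  have 1: "(\<lambda>n. dyadic_hom n (a \<oplus> b) - dyadic_hom n a - dyadic_hom n b) \<longlonglongrightarrow> hom (a \<oplus> b) - hom a - hom b"
    by (intro tendsto_intros dyadic_hom_tendsto)
  have 2: "(\<lambda>n. 2 * (1/2::real) ^ n) \<longlonglongrightarrow> 2 * 0"
    by (intro tendsto_mult_left LIMSEQ_realpow_zero) auto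
  have "(\<lambda>n. dyadic_hom n (a \<oplus> b) - dyadic_hom n a - dyadic_hom n b) \<longlonglongrightarrow> 0"
  proof (rule Lim_null_comparison)
    show "\<forall>\<^sub>F n in sequentially. norm (dyadic_hom n (a \<oplus> b) - dyadic_hom n a - dyadic_hom n b) \<le> 2 * (1/2) ^ n"
      using dyadic_hom_add [OF assms] by (simp add: power_one_over)
  qed (use 2 in simp)
  with 1 show ?thesis
    using LIMSEQ_unique by fastforce
qed

lemma hom_std: "mv_hom_std pl ng z hom"
  unfolding mv_hom_std_def
proof (intro conjI allI)
  show "hom x \<in> {0..1}" "hom (ng x) = std_neg (hom x)" "hom z = 0" for x
    by (simp_all add: hom_bounds hom_ng hom_in std_neg_def)
  show "hom (x \<oplus> y) = std_plus (hom x) (hom y)" for x y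
  proof (cases "x \<odot> y \<in> m")
    case True
    then show ?thesis
      using hom_add hom_bounds(2) [of "x \<oplus> y"] by (simp add: std_plus_def)
  next
    case False
    \<comment> \<open>If x + y is not at most 1 modulo \<open>m\<close>, then by totality it is at
      least 1, so the complements are orthogonal; additivity for them bounds
      \<open>hom x + hom y\<close> below by 1.\<close>
    then have *: "ng x \<odot> ng y \<in> m"
      using mle_total by (metis mle_def ng_ng tm_comm)
    then have "hom (ng x \<oplus> ng y) = hom (ng x) + hom (ng y)"
      by (rule hom_add)
    moreover have "hom (x \<oplus> y) = 1"
      using hom_ng [of "x \<oplus> y"] hom_in [OF *] by (simp add: ng_add)
    ultimately show ?thesis
      using hom_bounds(2) [of "ng x \<oplus> ng y"] by (simp add: hom_ng std_plus_def)
  qed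
qed

end

section \<open>Homomorphisms to the standard algebra and their kernels\<close>

context mv begin

lemma hom_std_simps:
  assumes "mv_hom_std pl ng z h"
  shows "h (x \<oplus> y) = min 1 (h x + h y)" "h (ng x) = 1 - h x" "h z = 0" "0 \<le> h x" "h x \<le> 1"
    "h (x \<odot> y) = max 0 (h x + h y - 1)"
  using assms by (auto simp: mv_hom_std_def std_plus_def std_neg_def tm_def)

lemma hom_std_mono: assumes "mv_hom_std pl ng z h" "x \<preceq> y" shows "h x \<le> h y"
proof -
  have "h (ng x \<oplus> y) = h (ng z)"
    using assms(2) by (simp add: le_def)
  then show ?thesis
    by (simp add: hom_std_simps [OF assms(1)])
qed

lemma hom_std_kernel_ideal:
  assumes "mv_hom_std pl ng z h" shows "mv_ideal pl ng z {x. h x = 0}"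
  unfolding mv_ideal_def
  using hom_std_mono [OF assms] hom_std_simps(4) [OF assms]
  by (auto simp: hom_std_simps(1,3) [OF assms]) (metis antisym)

text \<open>The kernel fixes where a homomorphism is 0 and, through \<open>ng\<close>, where it is
  1. Hence h and h' share the term of the doubling identity that is 0 or 1, and their distance at a
  is half of that at the other term.\<close>

lemma hom_std_unique:
  assumes h: "mv_hom_std pl ng z h" and h': "mv_hom_std pl ng z h'"
    and ker: "\<And>x. h x = 0 \<longleftrightarrow> h' x = 0"
  shows "h = h'"
proof
  have "\<bar>h a - h' a\<bar> \<le> 1 / 2 ^ n" for n a
  proof (induction n arbitrary: a)
    case 0
    show ?case
      using hom_std_simps(4,5) [OF h, of a] hom_std_simps(4,5) [OF h', of a] by (simp add: abs_if)
  next
    case (Suc n)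
    have one: "h x = 1 \<longleftrightarrow> h' x = 1" for x
      using ker [of "ng x"] by (simp add: hom_std_simps(2) [OF h] hom_std_simps(2) [OF h'])
    have "h (a \<odot> a) = 0 \<longleftrightarrow> h' (a \<odot> a) = 0" "h (a \<oplus> a) = 1 \<longleftrightarrow> h' (a \<oplus> a) = 1"
      by (rule ker one)+
    then show ?case
      using Suc [of "a \<odot> a"] Suc [of "a \<oplus> a"]
      by (auto simp: hom_std_simps [OF h] hom_std_simps [OF h'] min_def max_def field_simps abs_if
          split: if_splits)
  qed
  moreover have "(\<lambda>n. 1 / 2 ^ n :: real) \<longlonglongrightarrow> 0"
    using LIMSEQ_realpow_zero [of "1/2 :: real"] by (simp add: power_one_over)
  ultimately have "\<bar>h a - h' a\<bar> \<le> 0" for a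
    using LIMSEQ_le_const by blast
  then show "h a = h' a" for a by force
qed

section \<open>The maximal spectrum\<close>

abbreviation "Mx \<equiv> mv_Max pl ng z"
abbreviation "Tx \<equiv> mv_max_topology pl ng z"
abbreviation "star \<equiv> mv_star pl ng z"

text \<open>Justifies the definite description in \<open>mv_star\<close>. The kernel of
  \<open>hom\<close> is a proper ideal containing \<open>m\<close>, so it equals \<open>m\<close> by
  maximality.\<close>

lemma kernel_of_point:
  assumes m: "m \<in> Mx"
  obtains h where "mv_hom_std pl ng z h" "{x. h x = 0} = m" "\<And>a. star a m = h a"
proof -
  interpret mv_max pl ng z m
    using m by unfold_locales (simp add: mv_Max_def)
  have "m \<subseteq> {x. hom x = 0}"
    using hom_in by blast
  moreover have "hom (ng z) \<noteq> 0"
    by (simp add: hom_ng hom_in)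
  then have "{x. hom x = 0} \<noteq> UNIV"
    by blast
  ultimately have ker: "{x. hom x = 0} = m"
    using maximal_eq [OF hom_std_kernel_ideal [OF hom_std]] by simp
  have "star a m = hom a" for a
    unfolding mv_star_def restrict_apply'[OF m]
  proof (rule the_equality)
    show "\<exists>h. mv_hom_std pl ng z h \<and> {x. h x = 0} = m \<and> h a = hom a"
      using hom_std ker by blast
    show "r = hom a" if ex: "\<exists>h. mv_hom_std pl ng z h \<and> {x. h x = 0} = m \<and> h a = r" for r
    proof -
      obtain h where h: "mv_hom_std pl ng z h" "{x. h x = 0} = m" "h a = r"
        using ex by blast
      have "h = hom"
        by (rule hom_std_unique [OF h(1) hom_std]) (use h(2) ker in blast)
      then show ?thesis using h(3) by simp
    qed
  qed
  then show thesis
    using that hom_std ker by blast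
qed

lemma star_simps:
  assumes "m \<in> Mx"
  shows "star (x \<oplus> y) m = min 1 (star x m + star y m)" "star (ng x) m = 1 - star x m"
    "star z m = 0" "0 \<le> star x m" "star x m \<le> 1"
    "star (x \<odot> y) m = max 0 (star x m + star y m - 1)"
proof -
  obtain h where "mv_hom_std pl ng z h" "{x. h x = 0} = m" and eq: "\<And>a. star a m = h a"
    using kernel_of_point [OF assms] by blast
  note * = hom_std_simps [OF this(1)]
  show "star (x \<oplus> y) m = min 1 (star x m + star y m)" "star (ng x) m = 1 - star x m"
    "star z m = 0" "0 \<le> star x m" "star x m \<le> 1"
    "star (x \<odot> y) m = max 0 (star x m + star y m - 1)"
    by (simp_all only: eq *)
qed

lemma star_meet: "m \<in> Mx \<Longrightarrow> star (meet x y) m = min (star x m) (star y m)"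
  using star_simps(4,5) [of m x] star_simps(4,5) [of m y]
  by (auto simp: meet_eq star_simps min_def max_def)

lemma star_eq_0_iff: "m \<in> Mx \<Longrightarrow> star x m = 0 \<longleftrightarrow> x \<in> m"
  by (rule kernel_of_point) auto

lemma star_separates:
  assumes "m \<in> Mx" "n \<in> Mx" "m \<noteq> n"
  obtains a where "star a m = 0" "star a n > 0"
proof -
  have "\<not> m \<subseteq> n"
    using assms unfolding mv_Max_def mv_maximal_ideal_def by blast
  then obtain a where "a \<in> m" "a \<notin> n" by blast
  then have "star a m = 0" "star a n \<noteq> 0"
    using assms by (simp_all add: star_eq_0_iff)
  then show thesis
    using that star_simps(4) [OF assms(2), of a] by simp
qed

text \<open>An ideal strictly above the kernel contains some x with positive value. Doubling stays
  in the ideal and, by the Archimedean property, reaches the value 1; the complement of that element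
  is in the kernel, so the ideal contains 1.\<close>

lemma hom_std_kernel_in_Max:
  assumes h: "mv_hom_std pl ng z h" shows "{x. h x = 0} \<in> Mx"
  unfolding mv_Max_def mv_maximal_ideal_def mem_Collect_eq
proof (intro conjI allI impI)
  let ?K = "{x. h x = 0}"
  show "mv_ideal pl ng z ?K"
    by (rule hom_std_kernel_ideal [OF h])
  have "h (ng z) \<noteq> 0"
    by (simp add: hom_std_simps [OF h])
  then show "?K \<noteq> UNIV" by blast
  fix J assume J: "mv_ideal pl ng z J \<and> ?K \<subseteq> J"
  show "J = ?K \<or> J = UNIV"
  proof (rule disjCI)
    assume "J \<noteq> UNIV"
    have "h x = 0" if x: "x \<in> J" for x
    proof (rule ccontr)
      assume "h x \<noteq> 0"
      then have pos: "h x > 0"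
        using hom_std_simps(4) [OF h, of x] by simp
      have dbl: "((\<lambda>y. y \<oplus> y) ^^ n) x \<in> J \<and> h (((\<lambda>y. y \<oplus> y) ^^ n) x) = min 1 (2 ^ n * h x)" for n
      proof (induction n)
        case 0
        then show ?case using x hom_std_simps(5) [OF h, of x] by simp
      next
        case (Suc n)
        then show ?case
          using J unfolding mv_ideal_def by (auto simp: hom_std_simps(1) [OF h] min_def)
      qed
      obtain n where "1 / h x < 2 ^ n"
        using real_arch_pow [of 2 "1 / h x"] by auto
      then have "1 \<le> 2 ^ n * h x"
        using pos by (simp add: field_simps)
      then obtain y where y: "y \<in> J" "h y = 1"
        using dbl [of n] by auto
      then have "ng y \<in> J"
        using J by (auto simp: hom_std_simps(2) [OF h])
      then have "ng z \<in> J"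
        using y(1) J ng_add_self(2) [of y] unfolding mv_ideal_def by force
      then have "J = UNIV"
        using J le_one unfolding mv_ideal_def by blast
      then show False using \<open>J \<noteq> UNIV\<close> by contradiction
    qed
    then show "J = ?K" using J by blast
  qed
qed

lemma point_prime: assumes "m \<in> Mx" "meet x y \<in> m" shows "x \<in> m \<or> y \<in> m"
proof -
  have "min (star x m) (star y m) = 0"
    using assms by (simp add: star_eq_0_iff flip: star_meet)
  then show ?thesis
    by (simp add: min_def star_eq_0_iff assms split: if_splits)
qed

lemma point_meet: assumes "m \<in> Mx" "x \<in> m \<or> y \<in> m" shows "meet x y \<in> m"
proof -
  have "star (meet x y) m = 0"
    using assms star_simps(4) [OF assms(1)] by (auto simp: star_meet min_def simp flip: star_eq_0_iff intro: antisym)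
  then show ?thesis using assms by (simp add: star_eq_0_iff)
qed

text \<open>\<open>topology\<close> returns the intended family only once that family is known to be
  a topology. For intersections, primeness is used: m contains all meets of elements of A with
  elements of B exactly when it contains A or B.\<close>

lemma openin_max: "openin Tx U \<longleftrightarrow> (\<exists>S. U = Mx - {m \<in> Mx. S \<subseteq> m})"
proof -
  have "istopology (\<lambda>U. \<exists>S. U = Mx - {m \<in> Mx. S \<subseteq> m})"
    unfolding istopology_def
  proof (rule conjI; intro allI impI)
    fix U V assume "\<exists>S. U = Mx - {m \<in> Mx. S \<subseteq> m}" "\<exists>S. V = Mx - {m \<in> Mx. S \<subseteq> m}"
    then obtain A B where U: "U = Mx - {m \<in> Mx. A \<subseteq> m}" and V: "V = Mx - {m \<in> Mx. B \<subseteq> m}"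
      by blast
    have "{meet x y |x y. x \<in> A \<and> y \<in> B} \<subseteq> m \<longleftrightarrow> A \<subseteq> m \<or> B \<subseteq> m" if "m \<in> Mx" for m
      using point_prime [OF that] point_meet [OF that] by blast
    then have "U \<inter> V = Mx - {m \<in> Mx. {meet x y |x y. x \<in> A \<and> y \<in> B} \<subseteq> m}"
      unfolding U V by blast
    then show "\<exists>S. U \<inter> V = Mx - {m \<in> Mx. S \<subseteq> m}" by blast
  next
    fix \<U> :: "'a set set set" assume "\<forall>U\<in>\<U>. \<exists>S. U = Mx - {m \<in> Mx. S \<subseteq> m}"
    then obtain S where "\<And>U. U \<in> \<U> \<Longrightarrow> U = Mx - {m \<in> Mx. S U \<subseteq> m}"
      by metis
    then have "\<Union>\<U> = (\<Union>U\<in>\<U>. Mx - {m \<in> Mx. S U \<subseteq> m})"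
      by auto
    also have "\<dots> = Mx - {m \<in> Mx. (\<Union>U\<in>\<U>. S U) \<subseteq> m}"
      by blast
    finally show "\<exists>S. \<Union>\<U> = Mx - {m \<in> Mx. S \<subseteq> m}" by blast
  qed
  then show ?thesis
    by (simp add: mv_max_topology_def)
qed

lemma topspace_max [simp]: "topspace Tx = Mx"
proof -
  have "openin Tx Mx"
    unfolding openin_max
  proof
    have "UNIV \<noteq> m" if "m \<in> Mx" for m
      using that unfolding mv_Max_def mv_maximal_ideal_def by blast
    then show "Mx = Mx - {m \<in> Mx. UNIV \<subseteq> m}" by blast
  qed
  moreover have "topspace Tx \<subseteq> Mx"
    using openin_topspace [of Tx] unfolding openin_max by blast
  ultimately show ?thesis
    using openin_subset by blast
qed

lemma openin_cozero: "openin Tx {m \<in> Mx. star a m > 0}"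
  unfolding openin_max
proof
  have "star a m > 0 \<longleftrightarrow> a \<notin> m" if "m \<in> Mx" for m
    using star_eq_0_iff [OF that, of a] star_simps(4) [OF that, of a] by auto
  then show "{m \<in> Mx. star a m > 0} = Mx - {m \<in> Mx. {a} \<subseteq> m}" by auto
qed

lemma compact_hom_std: "compact {h. mv_hom_std pl ng z h}"
proof -
  let ?P = "PiE UNIV (\<lambda>_. {0..1}) :: ('a \<Rightarrow> real) set"
  have "compactin (product_topology (\<lambda>_. euclidean) UNIV) ?P"
    by (simp add: compactin_PiE)
  then have "compact ?P"
    by (simp add: euclidean_product_topology)
  moreover have "closed {h :: 'a \<Rightarrow> real. (\<forall>x y. h (x \<oplus> y) = min 1 (h x + h y)) \<and> (\<forall>x. h (ng x) = 1 - h x) \<and> h z = 0}"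
    by (intro closed_Collect_conj closed_Collect_all closed_Collect_eq continuous_intros
        continuous_on_product_coordinates)
  moreover have "{h. mv_hom_std pl ng z h} = ?P \<inter>
      {h. (\<forall>x y. h (x \<oplus> y) = min 1 (h x + h y)) \<and> (\<forall>x. h (ng x) = 1 - h x) \<and> h z = 0}"
    by (auto simp: mv_hom_std_def std_plus_def std_neg_def PiE_UNIV_domain)
  ultimately show ?thesis
    by (simp add: compact_Int_closed)
qed

lemma compact_space_max: "compact_space Tx"
proof -
  let ?H = "{h. mv_hom_std pl ng z h}" and ?ker = "\<lambda>h :: 'a \<Rightarrow> real. {x. h x = 0}"
  have "continuous_map (top_of_set ?H) Tx ?ker"
    unfolding continuous_map_def
  proof (intro conjI allI impI)
    show "?ker \<in> topspace (top_of_set ?H) \<rightarrow> topspace Tx"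
      using hom_std_kernel_in_Max by auto
    fix U assume "openin Tx U"
    then obtain S where U: "U = Mx - {m \<in> Mx. S \<subseteq> m}"
      unfolding openin_max by blast
    have "open (\<Union>a\<in>S. {h :: 'a \<Rightarrow> real. h a \<noteq> 0})"
      by (intro open_UN ballI open_Collect_neq continuous_intros continuous_on_product_coordinates)
    moreover have "{h \<in> topspace (top_of_set ?H). ?ker h \<in> U} = ?H \<inter> (\<Union>a\<in>S. {h. h a \<noteq> 0})"
      unfolding U using hom_std_kernel_in_Max by auto
    ultimately show "openin (top_of_set ?H) {h \<in> topspace (top_of_set ?H). ?ker h \<in> U}"
      by (simp add: openin_open_Int)
  qed
  moreover have "compactin (top_of_set ?H) ?H"
    using compact_hom_std by (simp add: compactin_subtopology)
  ultimately have "compactin Tx (?ker ` ?H)"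
    by (rule image_compactin [rotated])
  moreover have "?ker ` ?H = Mx"
  proof
    show "Mx \<subseteq> ?ker ` ?H"
    proof
      fix m assume "m \<in> Mx"
      then obtain h where "mv_hom_std pl ng z h" "{x. h x = 0} = m"
        by (rule kernel_of_point)
      then show "m \<in> ?ker ` ?H" by blast
    qed
  qed (use hom_std_kernel_in_Max in auto)
  ultimately show ?thesis
    by (simp add: compact_space_def)
qed

text \<open>
  Good sequences: \<open>good_seq as j\<close> represents the part of the sum of \<open>as\<close> between \<open>j\<close> and \<open>j + 1\<close>.
  Adding \<open>g\<close> passes the overflow of each entry on to the next one.
\<close>

primrec carry :: "(nat \<Rightarrow> 'a) \<Rightarrow> 'a \<Rightarrow> nat \<Rightarrow> 'a" where
  "carry T g 0 = g"
| "carry T g (Suc j) = T j \<odot> carry T g j"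

primrec good_seq :: "'a list \<Rightarrow> nat \<Rightarrow> 'a" where
  "good_seq [] = (\<lambda>j. z)"
| "good_seq (a # as) = (\<lambda>j. good_seq as j \<oplus> carry (good_seq as) a j)"

text \<open>Stack g on top of the height F. The value is the length of the part of the interval from
  F to F + g that lies above j, which is what remains after filling the first j entries.\<close>

lemma star_carry:
  assumes m: "m \<in> Mx" and T: "\<And>j. star (T j) m = max 0 (min 1 (F - real j))" and F: "0 \<le> F"
  shows "star (carry T g j) m = max 0 (min (star g m) (F + star g m - real j))"
proof (induction j)
  case 0
  show ?case using star_simps(4) [OF m, of g] F by (simp add: min_def max_def)
next
  case (Suc j)
  show ?case
    using star_simps(4,5) [OF m, of g] F
    by (simp add: star_simps(6) [OF m] Suc T min_def max_def)
qed

lemma star_sum_bounds: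
  "m \<in> Mx \<Longrightarrow> 0 \<le> (\<Sum>a\<leftarrow>as. star a m) \<and> (\<Sum>a\<leftarrow>as. star a m) \<le> real (length as)"
proof (induction as)
  case (Cons a as)
  then show ?case using star_simps(4,5) [of m a] by simp
qed simp

lemma star_good_seq:
  assumes m: "m \<in> Mx"
  shows "star (good_seq as j) m = max 0 (min 1 ((\<Sum>a\<leftarrow>as. star a m) - real j))"
proof (induction as arbitrary: j)
  case Nil
  then show ?case by (simp add: star_simps(3) [OF m])
next
  case (Cons a as)
  let ?F = "\<Sum>a\<leftarrow>as. star a m"
  have "0 \<le> ?F" using star_sum_bounds [OF m] by blast
  then show ?case
    using star_simps(4,5) [OF m, of a]
    by (simp add: star_simps(1) [OF m] star_carry [OF m Cons] Cons min_def max_def)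
qed

text \<open>The inequality a^*(m) > j/n says that n copies of a add up to more than j at m, that is,
  entry j of their good sequence does not vanish there: a cozero set. For r at least 0 take the
  union over all fractions j/n not below r; for negative r the set is the whole space.\<close>

lemma openin_star_greater: "openin Tx {m \<in> Mx. star a m > r}"
proof (cases "r < 0")
  case True
  then have "{m \<in> Mx. star a m > r} = Mx"
    using star_simps(4) by (force intro: less_le_trans)
  then show ?thesis
    using openin_topspace [of Tx] by simp
next
  case False
  let ?U = "\<lambda>(j, n). {m \<in> Mx. star (good_seq (replicate n a) j) m > 0}"
  let ?Q = "{(j, n :: nat). 0 < n \<and> r \<le> real j / real n}"
  have "{m \<in> Mx. star a m > r} = (\<Union>q\<in>?Q. ?U q)"
  proof (intro equalityI subsetI)
    fix m assume "m \<in> {m \<in> Mx. star a m > r}"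
    then have m: "m \<in> Mx" "r < star a m" by auto
    obtain q where q: "q \<in> \<rat>" "r < q" "q < star a m"
      using Rats_dense_in_real [OF m(2)] by blast
    then obtain j n :: nat where jn: "n \<noteq> 0" "\<bar>q\<bar> = real j / real n"
      using Rats_abs_nat_div_natE by metis
    with q False have eq: "q = real j / real n" by simp
    then have "real j = real n * q"
      using jn by simp
    then have "real j < real n * star a m" "r \<le> real j / real n"
      using jn q by (simp_all flip: eq)
    then show "m \<in> (\<Union>q\<in>?Q. ?U q)"
      using m jn by (intro UN_I [of "(j, n)"]) (auto simp: star_good_seq sum_list_replicate)
  next
    fix m assume "m \<in> (\<Union>q\<in>?Q. ?U q)"
    then obtain j n where m: "m \<in> Mx" and n: "0 < n" "r \<le> real j / real n"
      and "star (good_seq (replicate n a) j) m > 0" by auto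
    then have "real j < real n * star a m"
      by (auto simp: star_good_seq sum_list_replicate)
    then have "real j / real n < star a m"
      using n by (simp add: field_simps)
    then show "m \<in> {m \<in> Mx. star a m > r}"
      using m n by simp
  qed
  moreover have "openin Tx (\<Union>q\<in>?Q. ?U q)"
    using openin_cozero by (intro openin_Union) auto
  ultimately show ?thesis by simp
qed

lemma openin_star_less: "openin Tx {m \<in> Mx. star a m < r}"
proof -
  have "{m \<in> Mx. star a m < r} = {m \<in> Mx. star (ng a) m > 1 - r}"
    by (auto simp: star_simps(2))
  then show ?thesis
    by (simp add: openin_star_greater)
qed

lemma continuous_map_star: "continuous_map Tx euclideanreal (star a)"
  by (simp add: continuous_map_upper_lower_semicontinuous_lt openin_star_greater openin_star_less)

lemma star_in_cfun: "star a \<in> cfun Tx"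
  using continuous_map_star by (simp add: cfun_def) (simp add: mv_star_def)

end

section \<open>Uniform approximation by linear combinations\<close>

lemma continuous_map_real_uniform_approx:
  fixes f :: "'x \<Rightarrow> real"
  assumes approx: "\<And>\<epsilon>. \<epsilon> > 0 \<Longrightarrow>
    \<exists>g. continuous_map X euclideanreal g \<and> (\<forall>x\<in>topspace X. \<bar>f x - g x\<bar> \<le> \<epsilon>)"
  shows "continuous_map X euclideanreal f"
proof -
  have open_gt: "openin X {x \<in> topspace X. h x > r}"
    if h: "\<And>\<epsilon>. \<epsilon> > 0 \<Longrightarrow>
      \<exists>g. continuous_map X euclideanreal g \<and> (\<forall>x\<in>topspace X. \<bar>h x - g x\<bar> \<le> \<epsilon>)"
    for h :: "'x \<Rightarrow> real" and r
  proof (subst openin_subopen, intro ballI)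
    fix x assume x: "x \<in> {x \<in> topspace X. h x > r}"
    \<comment> \<open>One third of the gap is lost in passing from h to g at x, one in returning
      from g to h at y, and one keeps the inequality strict.\<close>
    define \<epsilon> where "\<epsilon> = (h x - r) / 3"
    have h_x: "h x = r + 3 * \<epsilon>"
      unfolding \<epsilon>_def by (simp add: field_simps)
    have "\<epsilon> > 0"
      using x unfolding \<epsilon>_def by simp
    then obtain g where g: "continuous_map X euclideanreal g"
      and hg: "\<And>x. x \<in> topspace X \<Longrightarrow> \<bar>h x - g x\<bar> \<le> \<epsilon>"
      using h by blast
    have "openin X {x \<in> topspace X. g x > r + \<epsilon>}"
      using g unfolding continuous_map_upper_lower_semicontinuous_lt by blast
    moreover have "g x > r + \<epsilon>"
      using abs_le_D1 [OF hg [of x]] x \<open>\<epsilon> > 0\<close> by (simp add: h_x)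
    moreover have "h y > r" if "y \<in> topspace X" "g y > r + \<epsilon>" for y
      using abs_le_D2 [OF hg [OF that(1)]] that(2) by simp
    ultimately show "\<exists>T. openin X T \<and> x \<in> T \<and> T \<subseteq> {x \<in> topspace X. h x > r}"
      using x by (intro exI [of _ "{x \<in> topspace X. g x > r + \<epsilon>}"]) auto
  qed
  have "\<exists>g. continuous_map X euclideanreal g \<and> (\<forall>x\<in>topspace X. \<bar>- f x - g x\<bar> \<le> \<epsilon>)"
    if pos: "\<epsilon> > 0" for \<epsilon>
  proof -
    obtain g where g: "continuous_map X euclideanreal g" "\<forall>x\<in>topspace X. \<bar>f x - g x\<bar> \<le> \<epsilon>"
      using approx [OF pos] by blast
    have "continuous_map X euclideanreal (\<lambda>x. - g x)"
      using g(1) by (rule continuous_map_minus)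
    moreover have "\<forall>x\<in>topspace X. \<bar>- f x - - g x\<bar> \<le> \<epsilon>"
      using g(2) by (simp add: abs_minus_commute)
    ultimately show ?thesis by blast
  qed
  from open_gt [of "\<lambda>x. - f x", OF this] have "openin X {x \<in> topspace X. - f x > - r}" for r
    by blast
  then have "openin X {x \<in> topspace X. f x < r}" for r
    by simp
  then show ?thesis
    using open_gt [OF approx] by (simp add: continuous_map_upper_lower_semicontinuous_lt)
qed

text \<open>Only the step k with k < F < k + 1 is undetermined, which accounts for the error 1.
  Capping F at n makes the claim inductive: beyond F nothing is added, and before F all earlier
  steps equal 1.\<close>

lemma staircase_sum:
  fixes t :: "nat \<Rightarrow> real"
  assumes t: "\<And>k. 0 \<le> t k" "\<And>k. t k \<le> 1" "\<And>k. F \<le> real k \<Longrightarrow> t k = 0"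
    "\<And>k. real k + 1 \<le> F \<Longrightarrow> t k = 1" and F: "0 \<le> F"
  shows "\<bar>min F (real n) - (\<Sum>k<n. t k)\<bar> \<le> 1"
proof (induction n)
  case 0
  then show ?case using F by simp
next
  case (Suc n)
  show ?case
  proof (cases "F \<le> real n")
    case True
    then show ?thesis using Suc t(3) [of n] by simp
  next
    case False
    have "t k = 1" if "k < n" for k
      by (rule t(4)) (use that False in linarith)
    then have sum: "(\<Sum>k<n. t k) = real n"
      by simp
    show ?thesis
      using False t(1,2,4) [of n] by (simp add: sum min_def abs_le_iff)
  qed
qed

text \<open>Keeping the combination formal allows one list to be evaluated at a point of Max M and
  at a state alike.\<close>

definition lin_comb :: "('a \<Rightarrow> real) \<Rightarrow> (real \<times> 'a) list \<Rightarrow> real"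
  where "lin_comb g cs = (\<Sum>(c, a)\<leftarrow>cs. c * g a)"

lemma lin_comb_simps [simp]:
  "lin_comb g [] = 0" "lin_comb g ((c, a) # cs) = c * g a + lin_comb g cs" "lin_comb g (cs @ ds) = lin_comb g cs + lin_comb g ds"
  by (simp_all add: lin_comb_def)

lemma lin_comb_scale [simp]: "lin_comb g (map (\<lambda>(c, a). (k * c, a)) cs) = k * lin_comb g cs"
  by (induction cs) (auto simp: algebra_simps)

lemma lin_comb_const [simp]: "lin_comb g (map (Pair c) as) = c * (\<Sum>a\<leftarrow>as. g a)"
  by (induction as) (auto simp: algebra_simps)

lemma sum_list_repeat:
  fixes g :: "'a \<Rightarrow> real"
  shows "(\<Sum>a\<leftarrow>concat (map (\<lambda>(c, a). replicate (q c) a) cs). g a) =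
    lin_comb g (map (\<lambda>(c, a). (real (q c), a)) cs)"
  by (induction cs) (auto simp: sum_list_replicate)

section \<open>Separation of closed sets and density of the span\<close>

context mv begin

lemma separate_points:
  assumes "x \<in> Mx" "y \<in> Mx" "x \<noteq> y"
  obtains a where "star a x = 1" "star a y = 0"
proof -
  obtain a where a: "star a y = 0" "star a x > 0"
    using star_separates [of y x] assms by blast
  have dbl: "star (((\<lambda>b. b \<oplus> b) ^^ n) a) m = min 1 (2 ^ n * star a m)" if "m \<in> Mx" for n m
    by (induction n) (use star_simps(4,5) [OF that, of a] in \<open>auto simp: star_simps(1) [OF that] min_def\<close>)
  obtain n where "1 / star a x < 2 ^ n"
    using real_arch_pow [of 2 "1 / star a x"] by auto
  then have "1 \<le> 2 ^ n * star a x"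
    using a(2) by (simp add: field_simps)
  then show thesis
    using that [of "((\<lambda>b. b \<oplus> b) ^^ n) a"] dbl assms a(1) by simp
qed

lemma separate_point_closed:
  assumes x: "x \<in> Mx" and K: "closedin Tx K" "x \<notin> K"
  obtains a where "star a x = 1" "\<And>m. m \<in> K \<Longrightarrow> star a m = 0"
proof -
  let ?B = "{b. star b x = 1}" and ?U = "\<lambda>b. {m \<in> Mx. star b m < 1/2}"
  have KM: "K \<subseteq> Mx"
    using closedin_subset [OF K(1)] by simp
  have "openin Tx U" if "U \<in> ?U ` ?B" for U
    using that openin_star_less by blast
  moreover have "K \<subseteq> \<Union>(?U ` ?B)"
  proof
    fix y assume "y \<in> K"
    then obtain b where "star b x = 1" "star b y = 0"
      using separate_points [of x y] x KM K(2) by blast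
    then show "y \<in> \<Union>(?U ` ?B)"
      using \<open>y \<in> K\<close> KM by auto
  qed
  ultimately obtain \<F> where F: "finite \<F>" "\<F> \<subseteq> ?U ` ?B" "K \<subseteq> \<Union>\<F>"
    using compactinD [OF closedin_compact_space [OF compact_space_max K(1)], of "?U ` ?B"] by blast
  obtain C where C: "C \<subseteq> ?B" "finite C" "\<F> = ?U ` C"
    using finite_subset_image [OF F(1,2)] by blast
  have "\<exists>d. star d x = 1 \<and> (\<forall>c\<in>C. \<forall>m\<in>Mx. star d m \<le> star c m)"
    using C(2,1)
  proof (induction C rule: finite_induct)
    case empty
    show ?case by (rule exI [of _ "ng z"]) (simp add: star_simps x)
  next
    case (insert c C)
    then obtain d where "star d x = 1" "\<forall>c\<in>C. \<forall>m\<in>Mx. star d m \<le> star c m"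
      by auto
    then show ?case
      using insert.prems by (intro exI [of _ "meet c d"]) (auto simp: star_meet x min_le_iff_disj)
  qed
  then obtain d where d: "star d x = 1" "\<And>c m. c \<in> C \<Longrightarrow> m \<in> Mx \<Longrightarrow> star d m \<le> star c m"
    by blast
  show thesis
  proof
    \<comment> \<open>Squaring sends every value below one half to exactly 0 and keeps the value
      1.\<close>
    show "star (d \<odot> d) x = 1"
      by (simp add: star_simps x d)
    fix m assume "m \<in> K"
    then obtain c where "c \<in> C" "m \<in> Mx" "star c m < 1/2"
      using F(3) C(3) by blast
    then show "star (d \<odot> d) m = 0"
      using d(2) [of c m] by (simp add: star_simps)
  qed
qed

text \<open>Urysohn's lemma inside M, by a second compactness argument. Sums take the place of
  meets, since they still vanish on K, and the final doubling lifts values above one half to exactly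
  1.\<close>

lemma separate_closed:
  assumes K: "closedin Tx K" and H: "closedin Tx H" and disj: "K \<inter> H = {}"
  obtains a where "\<And>m. m \<in> K \<Longrightarrow> star a m = 0" "\<And>m. m \<in> H \<Longrightarrow> star a m = 1"
proof -
  let ?B = "{b. \<forall>m\<in>K. star b m = 0}" and ?U = "\<lambda>b. {m \<in> Mx. star b m > 1/2}"
  have KM: "K \<subseteq> Mx" and HM: "H \<subseteq> Mx"
    using closedin_subset K H by fastforce+
  have "openin Tx U" if "U \<in> ?U ` ?B" for U
    using that openin_star_greater by blast
  moreover have "H \<subseteq> \<Union>(?U ` ?B)"
  proof
    fix x assume x: "x \<in> H"
    then have "x \<in> Mx" "x \<notin> K"
      using HM disj by auto
    from separate_point_closed [OF this(1) K this(2)]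
    obtain b where "star b x = 1" "\<And>m. m \<in> K \<Longrightarrow> star b m = 0"
      by blast
    then show "x \<in> \<Union>(?U ` ?B)"
      using \<open>x \<in> Mx\<close> by (intro UnionI [of "?U b"]) auto
  qed
  ultimately obtain \<F> where F: "finite \<F>" "\<F> \<subseteq> ?U ` ?B" "H \<subseteq> \<Union>\<F>"
    using compactinD [OF closedin_compact_space [OF compact_space_max H], of "?U ` ?B"] by blast
  obtain C where C: "C \<subseteq> ?B" "finite C" "\<F> = ?U ` C"
    using finite_subset_image [OF F(1,2)] by blast
  have "\<exists>d. (\<forall>m\<in>K. star d m = 0) \<and> (\<forall>c\<in>C. \<forall>m\<in>Mx. star c m \<le> star d m)"
    using C(2,1)
  proof (induction C rule: finite_induct)
    case empty
    show ?case
      using KM star_simps(3) by (intro exI [of _ z]) auto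
  next
    case (insert c C)
    then obtain d where d: "\<forall>m\<in>K. star d m = 0" "\<forall>c\<in>C. \<forall>m\<in>Mx. star c m \<le> star d m"
      by auto
    have "star (c \<oplus> d) m = 0" if "m \<in> K" for m
      using that KM d(1) insert.prems by (simp add: star_simps subset_iff)
    moreover have "star b m \<le> star (c \<oplus> d) m" if "b \<in> insert c C" and m: "m \<in> Mx" for b m
    proof -
      have "star b m \<le> star c m \<or> star b m \<le> star d m"
        using that d(2) by blast
      then show ?thesis
        using star_simps(4,5) [OF m, of c] star_simps(4,5) [OF m, of d] star_simps(5) [OF m, of b]
        by (auto simp: star_simps(1) [OF m])
    qed
    ultimately show ?case
      by (intro exI [of _ "c \<oplus> d"]) simp
  qed
  then obtain d where d: "\<And>m. m \<in> K \<Longrightarrow> star d m = 0"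
      "\<And>c m. c \<in> C \<Longrightarrow> m \<in> Mx \<Longrightarrow> star c m \<le> star d m"
    by blast
  show thesis
  proof
    show "star (d \<oplus> d) m = 0" if "m \<in> K" for m
      using that KM d(1) by (simp add: star_simps subset_iff)
    fix m assume "m \<in> H"
    then obtain c where "c \<in> C" "m \<in> Mx" "star c m > 1/2"
      using F(3) C(3) by blast
    then show "star (d \<oplus> d) m = 1"
      using d(2) [of c m] by (simp add: star_simps)
  qed
qed

lemma approx_unit_interval:
  assumes f: "continuous_map Tx euclideanreal f" and f01: "\<And>m. m \<in> Mx \<Longrightarrow> 0 \<le> f m \<and> f m \<le> 1"
    and n: "n > 0"
  obtains as where "\<And>m. m \<in> Mx \<Longrightarrow> \<bar>f m - (\<Sum>a\<leftarrow>as. star a m) / real n\<bar> \<le> 1 / real n"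
proof -
  \<comment> \<open>One stair: it climbs from 0 to 1 while n f climbs from k to k + 1.\<close>
  have "\<exists>a. (\<forall>m\<in>Mx. real n * f m \<le> real k \<longrightarrow> star a m = 0) \<and>
      (\<forall>m\<in>Mx. real k + 1 \<le> real n * f m \<longrightarrow> star a m = 1)" (is "\<exists>a. ?P k a") for k
  proof -
    let ?K = "{m \<in> Mx. f m \<in> {..real k / real n}}" and ?H = "{m \<in> Mx. f m \<in> {(real k + 1) / real n..}}"
    have K: "closedin Tx ?K" and H: "closedin Tx ?H"
      using closedin_continuous_map_preimage [OF f, of "{..real k / real n}"]
        closedin_continuous_map_preimage [OF f, of "{(real k + 1) / real n..}"] by simp_all
    have "?K \<inter> ?H = {}"
      using n by (auto simp: field_simps)
    from separate_closed [OF K H this] obtain a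
      where "\<And>m. m \<in> ?K \<Longrightarrow> star a m = 0" "\<And>m. m \<in> ?H \<Longrightarrow> star a m = 1" by blast
    then show ?thesis
      using n by (intro exI [of _ a]) (simp add: field_simps)
  qed
  then obtain a where "\<forall>k. ?P k (a k)"
    using choice [of ?P] by blast
  then have a: "\<And>k m. m \<in> Mx \<Longrightarrow> real n * f m \<le> real k \<Longrightarrow> star (a k) m = 0"
    "\<And>k m. m \<in> Mx \<Longrightarrow> real k + 1 \<le> real n * f m \<Longrightarrow> star (a k) m = 1"
    by blast+
  show thesis
  proof
    fix m assume m: "m \<in> Mx"
    have "\<bar>min (real n * f m) (real n) - (\<Sum>k<n. star (a k) m)\<bar> \<le> 1"
      by (rule staircase_sum) (use m a f01 n in \<open>simp_all add: star_simps\<close>)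
    moreover have "min (real n * f m) (real n) = real n * f m"
      using f01 [OF m] n by (simp add: min_def)
    ultimately have "\<bar>real n * f m - (\<Sum>k<n. star (a k) m)\<bar> / real n \<le> 1 / real n"
      by (simp add: divide_right_mono)
    also have "\<bar>real n * f m - (\<Sum>k<n. star (a k) m)\<bar> / real n =
        \<bar>(real n * f m - (\<Sum>k<n. star (a k) m)) / real n\<bar>"
      by simp
    also have "(real n * f m - (\<Sum>k<n. star (a k) m)) / real n = f m - (\<Sum>k<n. star (a k) m) / real n"
      using n by (simp add: field_simps)
    finally show "\<bar>f m - (\<Sum>a\<leftarrow>map a [0..<n]. star a m) / real n\<bar> \<le> 1 / real n"
      by (simp add: o_def interv_sum_list_conv_sum_set_nat atLeast0LessThan)
  qed
qed

lemma approx_continuous: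
  assumes f: "continuous_map Tx euclideanreal f" and \<epsilon>: "\<epsilon> > 0"
  obtains cs where "\<And>m. m \<in> Mx \<Longrightarrow> \<bar>f m - lin_comb (\<lambda>a. star a m) cs\<bar> \<le> \<epsilon>"
proof -
  have "compactin euclideanreal (f ` Mx)"
    using image_compactin [OF _ f, of Mx] compact_space_max by (simp add: compact_space_def)
  then have "bounded (f ` Mx)"
    by (simp add: compact_imp_bounded)
  then obtain B where B: "B > 0" "\<And>m. m \<in> Mx \<Longrightarrow> \<bar>f m\<bar> \<le> B"
    by (auto simp: bounded_pos)
  obtain n :: nat where n: "2 * B / \<epsilon> < real n"
    using reals_Archimedean2 by blast
  have "0 < 2 * B / \<epsilon>"
    using B(1) \<epsilon> by simp
  from less_trans [OF this n] have n0: "n > 0"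
    by simp
  \<comment> \<open>An affine change moves f into the unit interval. Undoing it multiplies the error
    1/n by 2B, which dictates the choice of n, and subtracts B, which the element
    \<open>ng z\<close> carries.\<close>
  let ?g = "\<lambda>m. (f m + B) / (2 * B)"
  have "continuous_map Tx euclideanreal ?g"
    using f B(1) by (intro continuous_intros) auto
  moreover have "0 \<le> ?g m \<and> ?g m \<le> 1" if "m \<in> Mx" for m
    using B(2) [OF that] B(1) by (simp add: field_simps abs_le_iff)
  ultimately obtain as where as: "\<And>m. m \<in> Mx \<Longrightarrow> \<bar>?g m - (\<Sum>a\<leftarrow>as. star a m) / real n\<bar> \<le> 1 / real n"
    using approx_unit_interval n0 by blast
  show thesis
  proof
    fix m assume m: "m \<in> Mx"
    let ?S = "\<Sum>a\<leftarrow>as. star a m"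
    have "f m - lin_comb (\<lambda>a. star a m) (map (Pair (2 * B / real n)) as @ [(- B, ng z)]) =
        2 * B * (?g m - ?S / real n)"
      using B(1) n0 by (simp add: star_simps m field_simps)
    also have "\<bar>\<dots>\<bar> = 2 * B * \<bar>?g m - ?S / real n\<bar>"
      using B(1) by (simp add: abs_mult)
    also have "\<dots> \<le> 2 * B * (1 / real n)"
      using as [OF m] B(1) by (intro mult_left_mono) auto
    also have "\<dots> \<le> \<epsilon>"
      using n n0 \<epsilon> by (simp add: field_simps)
    finally show "\<bar>f m - lin_comb (\<lambda>a. star a m) (map (Pair (2 * B / real n)) as @ [(- B, ng z)])\<bar> \<le> \<epsilon>" .
  qed
qed

text \<open>The upper envelope familiar from Hahn-Banach arguments: the infimum over all majorants
  in the span. It involves no choice of approximants and makes sense for any s, so it can be used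
  uniformly in the points of Max N.\<close>

definition extend :: "('a \<Rightarrow> real) \<Rightarrow> ('a set \<Rightarrow> real) \<Rightarrow> real"
  where "extend s f = Inf {lin_comb s cs |cs. \<forall>m\<in>Mx. f m \<le> lin_comb (\<lambda>a. star a m) cs}"

end

section \<open>States and their extension\<close>

locale mv_state = mv +
  fixes s :: "'a \<Rightarrow> real"
  assumes semisimple: "mv_semisimple pl ng z"
    and s_zero: "s z = 0" and s_one: "s (ng z) = 1" and s_nonneg: "\<And>a. 0 \<le> s a"
    and s_val: "\<And>x y. s (x \<oplus> y) + s (x \<odot> y) = s x + s y"
begin

lemma s_mono: assumes "x \<preceq> y" shows "s x \<le> s y"
proof -
  have "x \<odot> (y \<odot> ng x) = z"
    by (simp add: tm_left_comm [of x])
  then show ?thesis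
    using s_val [of x "y \<odot> ng x"] s_nonneg [of "y \<odot> ng x"] le_imp_add [OF assms] s_zero by simp
qed

lemma s_le_1: "s a \<le> 1"
  using s_mono [of a "ng z"] s_one by simp

lemma in_all_points_iff: "(\<forall>m\<in>Mx. a \<in> m) \<longleftrightarrow> a = z"
  using semisimple unfolding mv_semisimple_def by (auto simp: set_eq_iff)

text \<open>Semisimplicity of M enters here: an element that vanishes at every point is zero, so
  inequalities in M can be checked pointwise.\<close>

lemma le_iff_star: "x \<preceq> y \<longleftrightarrow> (\<forall>m\<in>Mx. star x m \<le> star y m)"
proof -
  have "x \<preceq> y \<longleftrightarrow> (\<forall>m\<in>Mx. star (x \<odot> ng y) m = 0)"
    by (simp add: le_iff_tm star_eq_0_iff in_all_points_iff)
  also have "\<dots> \<longleftrightarrow> (\<forall>m\<in>Mx. star x m \<le> star y m)"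
    by (auto simp: star_simps max_def)
  finally show ?thesis .
qed

text \<open>By \<open>s_val\<close> each step splits the mass of an entry and the incoming carry
  into the new entry and the outgoing carry, with nothing lost.\<close>

lemma sum_carry:
  "(\<Sum>j<k. s (T j \<oplus> carry T g j)) + s (carry T g k) = (\<Sum>j<k. s (T j)) + s g"
proof (induction k)
  case (Suc k)
  then show ?case using s_val [of "T k" "carry T g k"] by simp
qed simp

text \<open>A sum of n elements has height at most n, so after n entries the carry vanishes at every
  point and is therefore zero; \<open>sum_carry\<close> then leaves no remainder.\<close>

lemma sum_good_seq: "length as \<le> k \<Longrightarrow> (\<Sum>j<k. s (good_seq as j)) = (\<Sum>a\<leftarrow>as. s a)"
proof (induction as)
  case Nil
  then show ?case by (simp add: s_zero)
next
  case (Cons a as)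
  have "star (carry (good_seq as) a k) m = star z m" if m: "m \<in> Mx" for m
    using star_carry [OF m star_good_seq [OF m], of as a k] star_sum_bounds [OF m, of as]
      star_simps(5) [OF m, of a] Cons.prems by (simp add: star_simps(3) [OF m])
  then have "carry (good_seq as) a k \<preceq> z"
    unfolding le_iff_star by simp
  then have "s (carry (good_seq as) a k) = 0"
    by (simp add: s_zero)
  then show ?case
    using sum_carry [of "good_seq as" a k] Cons by simp
qed

lemma sum_state_mono:
  assumes "\<And>m. m \<in> Mx \<Longrightarrow> (\<Sum>a\<leftarrow>as. star a m) \<le> (\<Sum>b\<leftarrow>bs. star b m)"
  shows "(\<Sum>a\<leftarrow>as. s a) \<le> (\<Sum>b\<leftarrow>bs. s b)"
proof -
  \<comment> \<open>Long enough for both lists, so that \<open>sum_good_seq\<close> applies to each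
    with the same range of summation.\<close>
  let ?k = "max (length as) (length bs)"
  have "good_seq as j \<preceq> good_seq bs j" for j
    unfolding le_iff_star
  proof
    fix m assume m: "m \<in> Mx"
    show "star (good_seq as j) m \<le> star (good_seq bs j) m"
      using assms [OF m] by (simp add: star_good_seq [OF m] max_def min_def)
  qed
  then have "(\<Sum>j<?k. s (good_seq as j)) \<le> (\<Sum>j<?k. s (good_seq bs j))"
    by (intro sum_mono s_mono)
  then show ?thesis
    by (simp add: sum_good_seq)
qed

text \<open>Replacing each coefficient \<open>c\<close> by the integer \<open>\<lceil>N c\<rceil>\<close> costs at most one per term, which vanishes after division by \<open>N\<close>.\<close>

lemma lin_comb_state_nonneg:
  assumes "\<And>m. m \<in> Mx \<Longrightarrow> 0 \<le> lin_comb (\<lambda>a. star a m) cs"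
  shows "0 \<le> lin_comb s cs"
proof -
  have bound: "- real (length cs) \<le> real N * lin_comb s cs" for N :: nat
  proof -
    \<comment> \<open>\<open>rep id\<close> lists the elements with positive rounded coefficient and
      \<open>rep uminus\<close> those with negative one, each repeated as often as the absolute
      value says; \<open>nat\<close> discards the other sign. Comparing the two lists turns integer
      coefficients into plain sums.\<close>
    define rep where "rep q = concat (map (\<lambda>(c, a). replicate (nat (q \<lceil>real N * c\<rceil>)) a) cs)" for q
    have diff: "(\<Sum>a\<leftarrow>rep id. g a) - (\<Sum>a\<leftarrow>rep uminus. g a) =
        lin_comb g (map (\<lambda>(c, a). (of_int \<lceil>real N * c\<rceil>, a)) cs)" for g :: "'a \<Rightarrow> real"
      unfolding rep_def sum_list_repeat
    proof (induction cs)
      case (Cons p cs)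
      obtain c a where p: "p = (c, a)" by force
      have "real (nat k) * g a - real (nat (- k)) * g a = of_int k * g a" for k
        by (cases "0 \<le> k") auto
      from this [of "\<lceil>real N * c\<rceil>"] Cons show ?case
        by (simp add: p)
    qed simp
    have lower: "real N * lin_comb g cs \<le> lin_comb g (map (\<lambda>(c, a). (of_int \<lceil>real N * c\<rceil>, a)) cs)"
      if g: "\<And>a. 0 \<le> g a" for g :: "'a \<Rightarrow> real"
    proof (induction cs)
      case (Cons p cs)
      obtain c a where p: "p = (c, a)" by force
      have "real N * c * g a \<le> of_int \<lceil>real N * c\<rceil> * g a"
        using g by (intro mult_right_mono) auto
      then show ?case using Cons by (simp add: p algebra_simps)
    qed simp
    have upper: "lin_comb s (map (\<lambda>(c, a). (of_int \<lceil>real N * c\<rceil>, a)) cs) \<le> real N * lin_comb s cs + real (length cs)"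
    proof (induction cs)
      case (Cons p cs)
      obtain c a where p: "p = (c, a)" by force
      have "of_int \<lceil>real N * c\<rceil> * s a \<le> (real N * c + 1) * s a"
        using s_nonneg by (intro mult_right_mono) linarith+
      then show ?case using Cons s_le_1 [of a] by (simp add: p algebra_simps)
    qed simp
    have "(\<Sum>a\<leftarrow>rep uminus. star a m) \<le> (\<Sum>a\<leftarrow>rep id. star a m)" if m: "m \<in> Mx" for m
    proof -
      have "0 \<le> real N * lin_comb (\<lambda>a. star a m) cs"
        using assms [OF m] by simp
      also have "\<dots> \<le> (\<Sum>a\<leftarrow>rep id. star a m) - (\<Sum>a\<leftarrow>rep uminus. star a m)"
        unfolding diff by (rule lower) (rule star_simps(4) [OF m])
      finally show ?thesis by simp
    qed
    then have "(\<Sum>a\<leftarrow>rep uminus. s a) \<le> (\<Sum>a\<leftarrow>rep id. s a)"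
      by (rule sum_state_mono)
    then show ?thesis
      using diff [of s] upper by simp
  qed
  show ?thesis
  proof (rule ccontr)
    assume "\<not> 0 \<le> lin_comb s cs"
    then have neg: "0 < - lin_comb s cs" by simp
    obtain N :: nat where "real (length cs) / (- lin_comb s cs) < real N"
      using reals_Archimedean2 by blast
    then have "real (length cs) < real N * (- lin_comb s cs)"
      by (rule pos_divide_less_eq [OF neg, THEN iffD1])
    then show False using bound [of N] by simp
  qed
qed

lemma lin_comb_state_mono:
  assumes "\<And>m. m \<in> Mx \<Longrightarrow> lin_comb (\<lambda>a. star a m) cs \<le> lin_comb (\<lambda>a. star a m) ds"
  shows "lin_comb s cs \<le> lin_comb s ds"
  using lin_comb_state_nonneg [of "ds @ map (\<lambda>(c, a). (- 1 * c, a)) cs"] assms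
  by (simp only: lin_comb_simps lin_comb_scale) simp

text \<open>Raising \<open>cs\<close> by \<epsilon> gives a majorant of f, while every majorant
  raised by \<epsilon> dominates \<open>cs\<close>; so the infimum is caught between. Additivity,
  homogeneity, positivity and continuity in the point of Max N are read off this estimate.\<close>

lemma extend_approx:
  assumes "\<And>m. m \<in> Mx \<Longrightarrow> \<bar>f m - lin_comb (\<lambda>a. star a m) cs\<bar> \<le> \<epsilon>"
  shows "\<bar>extend s f - lin_comb s cs\<bar> \<le> \<epsilon>"
proof -
  let ?A = "{lin_comb s cs |cs. \<forall>m\<in>Mx. f m \<le> lin_comb (\<lambda>a. star a m) cs}"
  have low: "lin_comb s cs - \<epsilon> \<le> r" if "r \<in> ?A" for r
  proof -
    obtain ds where ds: "r = lin_comb s ds" "\<forall>m\<in>Mx. f m \<le> lin_comb (\<lambda>a. star a m) ds"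
      using \<open>r \<in> ?A\<close> by blast
    have "lin_comb s cs \<le> lin_comb s (ds @ [(\<epsilon>, ng z)])"
    proof (rule lin_comb_state_mono)
      fix m assume m: "m \<in> Mx"
      have "\<bar>f m - lin_comb (\<lambda>a. star a m) cs\<bar> \<le> \<epsilon>" "f m \<le> lin_comb (\<lambda>a. star a m) ds"
        using assms ds(2) m by auto
      then show "lin_comb (\<lambda>a. star a m) cs \<le> lin_comb (\<lambda>a. star a m) (ds @ [(\<epsilon>, ng z)])"
        by (simp add: star_simps(2,3) [OF m])
    qed
    then show ?thesis by (simp add: ds(1) s_one)
  qed
  have "f m \<le> lin_comb (\<lambda>a. star a m) (cs @ [(\<epsilon>, ng z)])" if m: "m \<in> Mx" for m
    using assms [OF m] by (simp add: star_simps(2,3) [OF m])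
  then have "lin_comb s (cs @ [(\<epsilon>, ng z)]) \<in> ?A"
    by blast
  then have up: "lin_comb s cs + \<epsilon> \<in> ?A"
    by (simp add: s_one)
  have "Inf ?A \<le> lin_comb s cs + \<epsilon>"
    by (rule cInf_lower [OF up bdd_belowI [OF low]])
  moreover have "lin_comb s cs - \<epsilon> \<le> Inf ?A"
    using up low by (intro cInf_greatest) auto
  ultimately show ?thesis
    unfolding extend_def by (simp add: abs_le_iff)
qed

lemma extend_lin_comb: "extend s (\<lambda>m. lin_comb (\<lambda>a. star a m) cs) = lin_comb s cs"
  using extend_approx [of "\<lambda>m. lin_comb (\<lambda>a. star a m) cs" cs 0] by simp

lemma extend_cong: "(\<And>m. m \<in> Mx \<Longrightarrow> f m = g m) \<Longrightarrow> extend s f = extend s g"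
  by (simp add: extend_def)

lemma extend_star: "extend s (star a) = s a"
  using extend_lin_comb [of "[(1, a)]"] by simp

lemma extend_add:
  assumes f: "continuous_map Tx euclideanreal f" and g: "continuous_map Tx euclideanreal g"
  shows "extend s (\<lambda>m. f m + g m) = extend s f + extend s g"
proof -
  have "\<bar>extend s (\<lambda>m. f m + g m) - (extend s f + extend s g)\<bar> \<le> 0 + \<epsilon>" if "\<epsilon> > 0" for \<epsilon>
  proof -
    \<comment> \<open>Four errors of size d occur: two in approximating the sum f + g, and one for
      each of f and g alone.\<close>
    define d where "d = \<epsilon> / 4"
    have d: "d > 0" "\<epsilon> = 4 * d"
      using that by (simp_all add: d_def)
    obtain cs where cs: "\<And>m. m \<in> Mx \<Longrightarrow> \<bar>f m - lin_comb (\<lambda>a. star a m) cs\<bar> \<le> d"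
      using approx_continuous [OF f d(1)] by blast
    obtain ds where ds: "\<And>m. m \<in> Mx \<Longrightarrow> \<bar>g m - lin_comb (\<lambda>a. star a m) ds\<bar> \<le> d"
      using approx_continuous [OF g d(1)] by blast
    have "\<bar>f m + g m - lin_comb (\<lambda>a. star a m) (cs @ ds)\<bar> \<le> 2 * d" if "m \<in> Mx" for m
      using abs_diff_triangle_ineq [of "f m" "g m"] cs [OF that] ds [OF that]
      unfolding lin_comb_simps mult_2
      by (rule order_trans [OF _ ordered_ab_semigroup_add_class.add_mono])
    from extend_approx [OF this] extend_approx [OF cs] extend_approx [OF ds] show ?thesis
      unfolding lin_comb_simps d(2) by linarith
  qed
  from field_le_epsilon [OF this] show ?thesis by simp
qed

lemma extend_scale:
  assumes f: "continuous_map Tx euclideanreal f"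
  shows "extend s (\<lambda>m. k * f m) = k * extend s f"
proof -
  have "\<bar>extend s (\<lambda>m. k * f m) - k * extend s f\<bar> \<le> 0 + \<epsilon>" if "\<epsilon> > 0" for \<epsilon>
  proof -
    \<comment> \<open>The error |k| d occurs twice, and the added 1 keeps the denominator nonzero
      when k = 0.\<close>
    define d where "d = \<epsilon> / (2 * (\<bar>k\<bar> + 1))"
    have d: "d > 0" "2 * (\<bar>k\<bar> * d) \<le> \<epsilon>"
      using that by (simp_all add: d_def field_simps)
    obtain cs where cs: "\<And>m. m \<in> Mx \<Longrightarrow> \<bar>f m - lin_comb (\<lambda>a. star a m) cs\<bar> \<le> d"
      using approx_continuous [OF f d(1)] by blast
    have scale: "\<bar>k * u - k * v\<bar> \<le> \<bar>k\<bar> * d" if "\<bar>u - v\<bar> \<le> d" for u v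
      using mult_left_mono [OF that, of "\<bar>k\<bar>"] by (simp add: right_diff_distrib flip: abs_mult)
    have "\<bar>k * f m - lin_comb (\<lambda>a. star a m) (map (\<lambda>(c, a). (k * c, a)) cs)\<bar> \<le> \<bar>k\<bar> * d" if "m \<in> Mx" for m
      using scale [OF cs [OF that]] by simp
    from extend_approx [OF this] scale [OF extend_approx [OF cs]] show ?thesis
      unfolding lin_comb_scale using d(2) by linarith
  qed
  from field_le_epsilon [OF this] show ?thesis by simp
qed

lemma extend_nonneg:
  assumes f: "continuous_map Tx euclideanreal f" and nonneg: "\<And>m. m \<in> Mx \<Longrightarrow> 0 \<le> f m"
  shows "0 \<le> extend s f"
proof (rule field_le_epsilon)
  fix \<epsilon> :: real assume "\<epsilon> > 0"
  then have \<epsilon>: "\<epsilon> / 2 > 0" by simp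
  obtain cs where cs: "\<And>m. m \<in> Mx \<Longrightarrow> \<bar>f m - lin_comb (\<lambda>a. star a m) cs\<bar> \<le> \<epsilon> / 2"
    using approx_continuous [OF f \<epsilon>] by blast
  have "0 \<le> lin_comb s (cs @ [(\<epsilon> / 2, ng z)])"
  proof (rule lin_comb_state_nonneg)
    fix m assume m: "m \<in> Mx"
    show "0 \<le> lin_comb (\<lambda>a. star a m) (cs @ [(\<epsilon> / 2, ng z)])"
      using abs_le_D1 [OF cs [OF m]] nonneg [OF m] by (simp add: star_simps(2,3) [OF m])
  qed
  then show "0 \<le> extend s f + \<epsilon>"
    using abs_le_D2 [OF extend_approx [OF cs]] by (simp add: s_one)
qed

end

section \<open>States obtained from a probability map\<close>

context mv begin

text \<open>(P1) gives only sums capped at 1, so the task is to show that the cap is inactive. The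
  disjoint case yields monotonicity, and monotonicity bounds the second summand by the state of a
  complement, which leaves room below 1.\<close>

lemma mv_state_prob_map:
  assumes ss: "mv_semisimple pl ng z" and N: "mv plN ngN zN" and p: "prob_map pl ng z plN ngN zN p"
    and y: "y \<in> mv_Max plN ngN zN"
  shows "mv_state pl ng z (\<lambda>a. mv_star plN ngN zN (p a) y)"
proof -
  interpret N: mv plN ngN zN by (rule N)
  let ?s = "\<lambda>a. N.star (p a) y"
  note star_N = N.star_simps [OF y]
  have bounds: "0 \<le> ?s a" "?s a \<le> 1" for a
    by (rule star_N)+
  have ng: "?s (ng a) = 1 - ?s a" for a
    using p star_N(2) by (simp add: prob_map_def)
  have "p (ng z) = ngN zN"
    using p unfolding prob_map_def by blast
  then have one: "?s (ng z) = 1"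
    by (simp add: star_N)
  have add: "?s (a \<oplus> b) = min 1 (?s a + ?s (meet b (ng a)))" for a b
    using p star_N(1) by (simp add: prob_map_def)
  have meet_eq': "meet b (ng a) = b \<odot> ng (b \<odot> a)" for a b
    by (simp add: meet_eq ng_tm)
  have orth: "?s (a \<oplus> b) = min 1 (?s a + ?s b)" if "b \<odot> a = z" for a b
    using add [of a b] that by (simp add: meet_eq')
  have mono: "?s b \<le> ?s c" if "b \<preceq> c" for b c
  proof -
    have "?s c = min 1 (?s b + ?s (c \<odot> ng b))"
      using orth [of "c \<odot> ng b" b] le_imp_add [OF that] by (simp add: tm_assoc)
    then show ?thesis
      using bounds [of b] bounds(1) [of "c \<odot> ng b"] by simp
  qed
  have val: "?s (a \<oplus> b) + ?s (a \<odot> b) = ?s a + ?s b" for a b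
  proof -
    \<comment> \<open>\<open>?v\<close> is both the meet of b with \<open>ng a\<close>, as in (P1),
      and the difference of b and \<open>?u\<close>; comparing the two readings eliminates
      it.\<close>
    let ?u = "b \<odot> a" and ?v = "b \<odot> ng (b \<odot> a)"
    have "?s ?v \<le> ?s (ng a)"
      using mono [OF meet_le2 [of b "ng a"]] by (simp add: meet_eq')
    then have 1: "?s (a \<oplus> b) = ?s a + ?s ?v"
      using add [of a b] ng [of a] by (simp add: meet_eq')
    have "?s ?v \<le> ?s (ng ?u)"
      by (intro mono tm_le)
    moreover have "?s b = min 1 (?s ?u + ?s ?v)"
      using orth [of ?v ?u] le_imp_add [of ?u b] by (simp add: tm_assoc)
    ultimately have "?s b = ?s ?u + ?s ?v"
      using ng [of ?u] by simp
    then show ?thesis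
      using 1 by (simp add: tm_comm [of a b])
  qed
  show ?thesis
  proof
    show "?s z = 0"
      using ng [of "ng z"] one by simp
  qed (use ss one bounds val in auto)
qed

end

section \<open>Existence and uniqueness of the operator\<close>

theorem theorem3p9:
  fixes plM :: "'a \<Rightarrow> 'a \<Rightarrow> 'a" and ngM :: "'a \<Rightarrow> 'a" and zM :: 'a
    and plN :: "'b \<Rightarrow> 'b \<Rightarrow> 'b" and ngN :: "'b \<Rightarrow> 'b" and zN :: 'b
    and p :: "'a \<Rightarrow> 'b"
  assumes "mv_algebra plM ngM zM" and "mv_algebra plN ngN zN"
    and "mv_semisimple plM ngM zM" and "mv_semisimple plN ngN zN"
    and "prob_map plM ngM zM plN ngN zN p"
  shows "\<exists>!L. L \<in> extensional (cfun (mv_max_topology plM ngM zM)) \<and>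
           unital_positive_linear (mv_max_topology plM ngM zM) (mv_max_topology plN ngN zN) L \<and>
           (\<forall>a. mv_star plN ngN zN (p a) = L (mv_star plM ngM zM a))"
proof -
  interpret M: mv plM ngM zM using assms(1) by unfold_locales
  interpret N: mv plN ngN zN using assms(2) by unfold_locales
  let ?s = "\<lambda>y a. N.star (p a) y"
  have state: "mv_state plM ngM zM (?s y)" if "y \<in> N.Mx" for y
    using M.mv_state_prob_map [OF assms(3) N.mv_axioms assms(5) that] .
  have cont: "continuous_map M.Tx euclideanreal f" if "f \<in> cfun M.Tx" for f
    using that by (simp add: cfun_def)
  have restrict_cfun: "restrict g M.Mx \<in> cfun M.Tx" if "continuous_map M.Tx euclideanreal g" for g
  proof -
    have "continuous_map M.Tx euclideanreal (restrict g M.Mx)"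
      by (rule continuous_map_eq [OF that]) simp
    then show ?thesis by (simp add: cfun_def)
  qed
  have cadd_in: "cadd M.Tx f g \<in> cfun M.Tx" if "f \<in> cfun M.Tx" "g \<in> cfun M.Tx" for f g
    unfolding cadd_def M.topspace_max
    by (intro restrict_cfun continuous_map_add cont that)
  have cscale_in: "cscale M.Tx c f \<in> cfun M.Tx" if "f \<in> cfun M.Tx" for c f
    unfolding cscale_def M.topspace_max
    by (intro restrict_cfun continuous_map_real_mult_left cont that)
  have cone_in: "cone M.Tx \<in> cfun M.Tx"
    unfolding cone_def M.topspace_max
    by (intro restrict_cfun) simp
  \<comment> \<open>The outer restriction makes L extensional, as uniqueness among total functions
    requires; the inner one makes each value extensional, as \<open>cfun\<close> demands.\<close>
  define L where "L = restrict (\<lambda>f. restrict (\<lambda>y. M.extend (?s y) f) N.Mx) (cfun M.Tx)"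
  have L: "L f y = M.extend (?s y) f" if "f \<in> cfun M.Tx" "y \<in> N.Mx" for f y
    using that by (simp add: L_def)
  have L_eqI: "L f = g" if "f \<in> cfun M.Tx" "g \<in> extensional N.Mx"
    "\<And>y. y \<in> N.Mx \<Longrightarrow> M.extend (?s y) f = g y" for f g
    using that by (intro extensionalityI [of _ N.Mx]) (auto simp: L_def)
  have one: "M.extend (?s y) (cone M.Tx) = 1" if y: "y \<in> N.Mx" for y
  proof -
    interpret mv_state plM ngM zM "?s y" by (rule state [OF y])
    have "M.extend (?s y) (cone M.Tx) = M.extend (?s y) (M.star (ngM zM))"
      by (rule extend_cong) (simp add: cone_def M.star_simps)
    then show ?thesis
      by (simp add: extend_star s_one)
  qed
  have L_in: "L f \<in> cfun N.Tx" if f: "f \<in> cfun M.Tx" for f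
  proof -
    have "continuous_map N.Tx euclideanreal (L f)"
    proof (rule continuous_map_real_uniform_approx)
      fix \<epsilon> :: real assume "\<epsilon> > 0"
      then obtain cs where cs: "\<And>m. m \<in> M.Mx \<Longrightarrow> \<bar>f m - lin_comb (\<lambda>a. M.star a m) cs\<bar> \<le> \<epsilon>"
        using M.approx_continuous [OF cont [OF f]] by blast
      have "continuous_map N.Tx euclideanreal (\<lambda>y. lin_comb (?s y) cs)"
        by (induction cs) (auto intro!: continuous_map_add continuous_map_real_mult_left
            N.continuous_map_star)
      \<comment> \<open>The bound of \<open>extend_approx\<close> does not depend on the state, so
        this approximation is uniform in y.\<close>
      moreover have "\<bar>L f y - lin_comb (?s y) cs\<bar> \<le> \<epsilon>" if "y \<in> N.Mx" for y
        using mv_state.extend_approx [OF state [OF that] cs] L [OF f that] by simp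
      ultimately show "\<exists>g. continuous_map N.Tx euclideanreal g \<and> (\<forall>y\<in>topspace N.Tx. \<bar>L f y - g y\<bar> \<le> \<epsilon>)"
        by auto
    qed
    then show ?thesis
      using f by (simp add: cfun_def) (simp add: L_def cfun_def)
  qed
  have "unital_positive_linear M.Tx N.Tx L"
    unfolding unital_positive_linear_def
  proof (intro conjI ballI allI impI)
    show "L f \<in> cfun N.Tx" if "f \<in> cfun M.Tx" for f
      using L_in that .
    show "L (cadd M.Tx f g) = cadd N.Tx (L f) (L g)" if fg: "f \<in> cfun M.Tx" "g \<in> cfun M.Tx" for f g
    proof (rule L_eqI [OF cadd_in [OF fg]])
      fix y assume y: "y \<in> N.Mx"
      interpret mv_state plM ngM zM "?s y" by (rule state [OF y])
      have "M.extend (?s y) (cadd M.Tx f g) = M.extend (?s y) (\<lambda>m. f m + g m)"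
        by (rule extend_cong) (simp add: cadd_def)
      then show "M.extend (?s y) (cadd M.Tx f g) = cadd N.Tx (L f) (L g) y"
        using y fg by (simp add: extend_add cont L cadd_def)
    qed (simp add: cadd_def)
    show "L (cscale M.Tx c f) = cscale N.Tx c (L f)" if f: "f \<in> cfun M.Tx" for c f
    proof (rule L_eqI [OF cscale_in [OF f]])
      fix y assume y: "y \<in> N.Mx"
      interpret mv_state plM ngM zM "?s y" by (rule state [OF y])
      have "M.extend (?s y) (cscale M.Tx c f) = M.extend (?s y) (\<lambda>m. c * f m)"
        by (rule extend_cong) (simp add: cscale_def)
      then show "M.extend (?s y) (cscale M.Tx c f) = cscale N.Tx c (L f) y"
        using y f by (simp add: extend_scale cont L cscale_def)
    qed (simp add: cscale_def)
    show "0 \<le> L f y" if "f \<in> cfun M.Tx" "\<forall>x\<in>topspace M.Tx. 0 \<le> f x" "y \<in> topspace N.Tx" for f y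
      using that mv_state.extend_nonneg [OF state cont, of y f] by (simp add: L)
    show "L (cone M.Tx) = cone N.Tx"
      by (rule L_eqI [OF cone_in]) (simp_all add: one cone_def [of N.Tx])
  qed
  moreover have "N.star (p a) = L (M.star a)" for a
  proof (rule L_eqI [OF M.star_in_cfun, symmetric])
    show "N.star (p a) \<in> extensional N.Mx"
      using N.star_in_cfun by (simp add: cfun_def)
  qed (simp add: mv_state.extend_star [OF state])
  moreover have "L' = L"
    if ext: "L' \<in> extensional (cfun M.Tx)" and L': "unital_positive_linear M.Tx N.Tx L'"
      and star: "\<forall>a. N.star (p a) = L' (M.star a)" for L'
  proof (rule extensionalityI [OF ext])
    show "L \<in> extensional (cfun M.Tx)"
      by (simp add: L_def)
    note L'D = L' [unfolded unital_positive_linear_def]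
    have L'_add: "L' (cadd M.Tx f g) y = L' f y + L' g y"
      if "f \<in> cfun M.Tx" "g \<in> cfun M.Tx" "y \<in> N.Mx" for f g y
      using L'D that by (simp add: cadd_def [of N.Tx])
    have L'_scale: "L' (cscale M.Tx c f) y = c * L' f y" if "f \<in> cfun M.Tx" "y \<in> N.Mx" for c f y
      using L'D that by (simp add: cscale_def [of N.Tx])
    have L'_one: "L' (cone M.Tx) y = 1" if "y \<in> N.Mx" for y
      using L'D that by (simp add: cone_def [of N.Tx])
    \<comment> \<open>Positivity applied to g - f. Monotonicity replaces an operator norm bound in
      the sandwich at the end.\<close>
    have L'_mono: "L' f y \<le> L' g y" if f: "f \<in> cfun M.Tx" and g: "g \<in> cfun M.Tx"
      and y: "y \<in> N.Mx" and le: "\<And>m. m \<in> M.Mx \<Longrightarrow> f m \<le> g m" for f g y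
    proof -
      let ?h = "cadd M.Tx g (cscale M.Tx (- 1) f)"
      have h: "?h \<in> cfun M.Tx"
        using f g by (intro cadd_in cscale_in)
      have "\<forall>m\<in>topspace M.Tx. 0 \<le> ?h m"
        using le by (simp add: cadd_def cscale_def)
      then have "0 \<le> L' ?h y"
        using L'D h y by simp
      also have "L' ?h y = L' g y - L' f y"
        using f g y by (simp add: L'_add L'_scale cscale_in)
      finally show ?thesis by simp
    qed
    let ?G = "\<lambda>cs. restrict (\<lambda>m. lin_comb (\<lambda>a. M.star a m) cs) M.Mx"
    have G: "?G cs \<in> cfun M.Tx \<and> (\<forall>y\<in>N.Mx. L' (?G cs) y = lin_comb (?s y) cs)" for cs
    proof (induction cs)
      case Nil
      \<comment> \<open>The zero function is written as 0 times the unit so that homogeneity of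
        \<open>L'\<close> gives its value.\<close>
      have eq: "?G [] = cscale M.Tx 0 (cone M.Tx)"
        by (simp add: cscale_def restrict_def fun_eq_iff)
      show ?case
        unfolding eq by (simp add: cscale_in cone_in L'_scale)
    next
      case (Cons q cs)
      obtain c a where q: "q = (c, a)" by force
      define g where "g = ?G cs"
      have g: "g \<in> cfun M.Tx" "\<And>y. y \<in> N.Mx \<Longrightarrow> L' g y = lin_comb (?s y) cs"
        unfolding g_def using Cons by blast+
      have eq: "?G (q # cs) = cadd M.Tx (cscale M.Tx c (M.star a)) g"
        by (simp add: q g_def cadd_def cscale_def restrict_def fun_eq_iff)
      show ?case
        unfolding eq
        by (simp add: q g star cadd_in cscale_in M.star_in_cfun L'_add L'_scale)
    qed
    show "L' f = L f" if f: "f \<in> cfun M.Tx" for f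
    proof (rule extensionalityI [of _ N.Mx])
      show "L' f \<in> extensional N.Mx" "L f \<in> extensional N.Mx"
        using L'D L_in f by (simp_all add: cfun_def)
      fix y assume y: "y \<in> N.Mx"
      have "\<bar>L' f y - L f y\<bar> \<le> 0 + \<epsilon>" if "\<epsilon> > 0" for \<epsilon>
      proof -
        obtain cs where cs: "\<And>m. m \<in> M.Mx \<Longrightarrow> \<bar>f m - lin_comb (\<lambda>a. M.star a m) cs\<bar> \<le> \<epsilon> / 2"
          using M.approx_continuous [OF cont [OF f], of "\<epsilon> / 2"] \<open>\<epsilon> > 0\<close> by auto
        let ?e = "cscale M.Tx (\<epsilon> / 2) (cone M.Tx)"
        have e: "?e \<in> cfun M.Tx" and e_val: "\<And>m. m \<in> M.Mx \<Longrightarrow> ?e m = \<epsilon> / 2"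
          and L'_e: "L' ?e y = \<epsilon> / 2"
          using y by (simp_all add: cscale_in cone_in L'_scale L'_one) (simp add: cscale_def cone_def)
        \<comment> \<open>Adding the constant \<open>?e\<close> puts f and \<open>?G cs\<close> each
          below the other, so \<open>L' f y\<close> is within \<epsilon>/2 of the value that
          \<open>L'\<close> is forced to take at \<open>?G cs\<close>. \<open>L f y\<close> is
          equally close to the same number.\<close>
        have "L' f y \<le> L' (cadd M.Tx (?G cs) ?e) y"
        proof (rule L'_mono [OF f cadd_in [OF _ e] y])
          show "f m \<le> cadd M.Tx (?G cs) ?e m" if "m \<in> M.Mx" for m
            using abs_le_D1 [OF cs [OF that]] that by (simp add: cadd_def e_val)
        qed (use G in blast)
        moreover have "L' (?G cs) y \<le> L' (cadd M.Tx f ?e) y"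
        proof (rule L'_mono [OF _ cadd_in [OF f e] y])
          show "?G cs m \<le> cadd M.Tx f ?e m" if "m \<in> M.Mx" for m
            using abs_le_D2 [OF cs [OF that]] that by (simp add: cadd_def e_val)
        qed (use G in blast)
        moreover have dist: "\<bar>L f y - lin_comb (?s y) cs\<bar> \<le> \<epsilon> / 2"
          using mv_state.extend_approx [OF state [OF y] cs] L [OF f y] by simp
        ultimately show ?thesis
          using G [of cs] f e y abs_le_D1 [OF dist] abs_le_D2 [OF dist]
          by (simp add: L'_add L'_e abs_le_iff)
      qed
      from field_le_epsilon [OF this] show "L' f y = L f y" by simp
    qed
  qed
  moreover have "L \<in> extensional (cfun M.Tx)"
    by (simp add: L_def)
  ultimately show ?thesis
    by blast
qed

end
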